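(* For every $\varepsilon>0$ there exists a $3$-connected simple cubic graph $G$ such that every traveling salesman tour of $G$ has length at least $(1.125-\varepsilon)\,|V(G)|$.
   Context: A traveling salesman tour (TSP tour) of a graph $G$ is a closed walk in $G$ that visits every vertex of $G$; its length is the number of edges traversed, counted with multiplicity. *)

theory Defs
  imports Complex_Main
begin

definition simple_graph :: "'a set \<Rightarrow> ('a \<Rightarrow> 'a \<Rightarrow> bool) \<Rightarrow> bool" where
  "simple_graph V E \<longleftrightarrow> finite V \<and> (\<forall>u v. E u v \<longrightarrow> u \<in> V \<and> v \<in> V)
     \<and> (\<forall>u v. E u v \<longrightarrow> E v u) \<and> (\<forall>v. \<not> E v v)"

definition degree :: "'a set \<Rightarrow> ('a \<Rightarrow> 'a \<Rightarrow> bool) \<Rightarrow> 'a \<Rightarrow> nat" where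
  "degree V E v = card {w \<in> V. E v w}"

definition cubic :: "'a set \<Rightarrow> ('a \<Rightarrow> 'a \<Rightarrow> bool) \<Rightarrow> bool" where
  "cubic V E \<longleftrightarrow> (\<forall>v\<in>V. degree V E v = 3)"

definition connected_on :: "'a set \<Rightarrow> ('a \<Rightarrow> 'a \<Rightarrow> bool) \<Rightarrow> bool" where
  "connected_on U E \<longleftrightarrow>
     (\<forall>u\<in>U. \<forall>v\<in>U. (\<lambda>x y. E x y \<and> x \<in> U \<and> y \<in> U)\<^sup>*\<^sup>* u v)"

definition k_connected :: "nat \<Rightarrow> 'a set \<Rightarrow> ('a \<Rightarrow> 'a \<Rightarrow> bool) \<Rightarrow> bool" where
  "k_connected k V E \<longleftrightarrow> card V > k \<and>
     (\<forall>S. S \<subseteq> V \<and> card S < k \<longrightarrow> connected_on (V - S) E)"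

definition tsp_tour :: "'a set \<Rightarrow> ('a \<Rightarrow> 'a \<Rightarrow> bool) \<Rightarrow> 'a list \<Rightarrow> bool" where
  "tsp_tour V E w \<longleftrightarrow> w \<noteq> [] \<and> hd w = last w
     \<and> (\<forall>i. Suc i < length w \<longrightarrow> E (w ! i) (w ! Suc i))
     \<and> set w = V"

definition tour_length :: "'a list \<Rightarrow> nat" where
  "tour_length w = length w - 1"

end

theory Submission
  imports Defs
begin

text \<open>
  Start from $K_4$ and repeatedly replace a vertex $v$ by a copy of the Petersen graph minus a vertex,
  whose three vertices of degree two (the ports) inherit the three edges at $v$. Each replacement
  adds $8$ vertices and lengthens the shortest tour by at least $9$, so the ratio tends to $9/8$.

  A tour is encoded by edge multiplicities in $\{0,1,2\}$ with even degrees and connected support.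
  Given such a multiplicity on the new graph, contract the fragment. If some doubled port edge can be
  dropped, the contraction exceeds the optimum by at least $2$, and the fragment contains weight at least $7$ by a degree
  count. Otherwise every doubled port edge is a bridge, hence the part of the tour inside the fragment is
  connected on its own. It then has weight at least $9$: weight $8$ would force all degrees to be minimal
  and produce a Hamiltonian cycle of the Petersen graph.
\<close>

section \<open>Weights on the fragment\<close>

text \<open>By parity, a connected tour part of weight 8 on the nine vertices would be a Hamiltonian
  path between two ports, which closes up through the deleted vertex. Excluding it makes a fragment
  cost 9 edges for 8 additional vertices, whence 9/8. The obstacle is a tour that meets the fragment
  in several pieces, for which only weight 7 is guaranteed inside. In that case some port edge is
  used twice without being a bridge after contraction; the 2 saved by dropping it make up for 9 -
  7.\<close>

lemma even_pos: "even (n::nat) \<Longrightarrow> n > 0 \<Longrightarrow> n \<ge> 2" by presburger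

text \<open>The lower bounds already add up to 16 once one of \<open>q\<close>, \<open>r\<close>,
  \<open>s\<close> is raised to 2, so each of them is attained. Here \<open>q\<close>,
  \<open>r\<close>, \<open>s\<close> stand for the inner degrees of the ports and the
  \<open>p\<close>s for the other six degrees.\<close>

lemma degrees_tight:
  fixes p1 p2 p3 p4 p5 p6 q r s :: nat
  assumes "p1 \<ge> 2" "p2 \<ge> 2" "p3 \<ge> 2" "p4 \<ge> 2" "p5 \<ge> 2" "p6 \<ge> 2" "q \<ge> 1" "r \<ge> 1" "s \<ge> 1"
    "q \<ge> 2 \<or> r \<ge> 2 \<or> s \<ge> 2" "p1+p2+p3+p4+p5+p6+q+r+s \<le> 16"
  shows "p1 = 2 \<and> p2 = 2 \<and> p3 = 2 \<and> p4 = 2 \<and> p5 = 2 \<and> p6 = 2 \<and>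
    (q = 2 \<and> r = 1 \<and> s = 1 \<or> q = 1 \<and> r = 2 \<and> s = 1 \<or> q = 1 \<and> r = 1 \<and> s = 2)"
  using assms(10)
proof (elim disjE)
  assume "q \<ge> 2"
  have "p1 = 2" "p2 = 2" "p3 = 2" "p4 = 2" "p5 = 2" "p6 = 2" "q = 2" "r = 1" "s = 1"
    using assms(1-9,11) \<open>q \<ge> 2\<close> by linarith+
  thus ?thesis by blast
next
  assume "r \<ge> 2"
  have "p1 = 2" "p2 = 2" "p3 = 2" "p4 = 2" "p5 = 2" "p6 = 2" "q = 1" "r = 2" "s = 1"
    using assms(1-9,11) \<open>r \<ge> 2\<close> by linarith+
  thus ?thesis by blast
next
  assume "s \<ge> 2"
  have "p1 = 2" "p2 = 2" "p3 = 2" "p4 = 2" "p5 = 2" "p6 = 2" "q = 1" "r = 1" "s = 2"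
    using assms(1-9,11) \<open>s \<ge> 2\<close> by linarith+
  thus ?thesis by blast
qed
text \<open>The complement of a perfect matching of the Petersen graph consists of two 5-cycles.\<close>

lemma two_factor_disconnected:
  fixes c0 c1 c2 c3 c4 c5 c6 c7 c8 d0 d1 d2 :: nat
  assumes "c8 = 1" "c0 = 1" "c0+c1+d0=2" "c1+c2+d2=2" "c2+c3=1" "c3+c4+d1=2" "c4+c5+d0=2" "c5+c6=1" "c6+c7+d2=2" "c7+c8+d1=2"
    and d: "d0 \<le> 1" "d1 \<le> 1" "d2 \<le> 1"
    and five: "c3+d1+c5+d0>0" "c0+d2+d1+c5>0" "c3+d0+d2+c8>0" "c6+d1+d0+c2>0" "c1+c5+c3+c7>0" "c4+c8+c6+c1>0" "c7+c2+c0+c4>0"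
  shows False
proof -
  \<comment> \<open>With both cycle edges at port \<open>0\<close> present, the degree equations
    determine every \<open>c\<close> from the three chords, which leaves eight cases.\<close>
  have e: "c1 = 1 - d0" "c7 = 1 - d1" using assms(1-3,10) by arith+
  have e2: "c2 = 2 - c1 - d2" using assms(4) by arith
  have e3: "c3 = 1 - c2" using assms(5) by arith
  have e4: "c6 = 2 - c7 - d2" using assms(9) by arith
  have e5: "c5 = 1 - c6" using assms(8) by arith
  have e6: "c4 = 2 - c5 - d0" using assms(7) by arith
  have "d0 = 0 \<or> d0 = 1" "d1 = 0 \<or> d1 = 1" "d2 = 0 \<or> d2 = 1" using d by arith+
  thus False using five assms(1,2,4-9) unfolding e6 e5 e4 e3 e2 e
    by (elim disjE; hypsubst; simp)
qed
text \<open>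
  Here \<open>c\<^sub>i\<close> is the multiplicity of the cycle edge joining \<open>i\<close> and \<open>i + 1\<close>, the
  \<open>d\<^sub>j\<close> those of the chords and the \<open>x\<^sub>j\<close> those of the port edges. The hypotheses record
  the parity of the nine degrees and the cut conditions at single vertices, at edges, and at the six
  5-cycles of the fragment.
\<close>

lemma connected_fragment_weight:
  fixes c0 c1 c2 c3 c4 c5 c6 c7 c8 d0 d1 d2 x0 x1 x2 :: nat
  assumes ev: "even (c8+c0+x0)" "even (c0+c1+d0)" "even (c1+c2+d2)" "even (c2+c3+x1)" "even (c3+c4+d1)"
    "even (c4+c5+d0)" "even (c5+c6+x2)" "even (c6+c7+d2)" "even (c7+c8+d1)"
  and single: "c8+c0>0" "c0+c1+d0>0" "c1+c2+d2>0" "c2+c3>0" "c3+c4+d1>0" "c4+c5+d0>0" "c5+c6>0" "c6+c7+d2>0" "c7+c8+d1>0"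
  and pairs: "c8+c1+d0>0" "c0+d0+c2+d2>0" "c1+d2+c3>0" "c2+c4+d1>0" "c3+d1+c5+d0>0" "c4+d0+c6>0" "c5+c7+d2>0" "c6+d2+c8+d1>0" "c7+d1+c0>0"
   "c0+c1+c4+c5>0" "c3+c4+c7+c8>0" "c6+c7+c1+c2>0"
  and fives: "c0+d2+d1+c5>0" "c3+d0+d2+c8>0" "c6+d1+d0+c2>0" "c1+c5+c3+c7>0" "c4+c8+c6+c1>0" "c7+c2+c0+c4>0"
  shows "c0+c1+c2+c3+c4+c5+c6+c7+c8+d0+d1+d2 \<ge> 9"
proof (rule ccontr)
  assume "\<not> ?thesis"
  hence le: "c0+c1+c2+c3+c4+c5+c6+c7+c8+d0+d1+d2 \<le> 8" by simp
  have deg: "c0+c1+d0\<ge>2" "c1+c2+d2\<ge>2" "c3+c4+d1\<ge>2" "c4+c5+d0\<ge>2" "c6+c7+d2\<ge>2" "c7+c8+d1\<ge>2"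
    by (rule even_pos[OF ev(2) single(2)] even_pos[OF ev(3) single(3)] even_pos[OF ev(5) single(5)]
      even_pos[OF ev(6) single(6)] even_pos[OF ev(8) single(8)] even_pos[OF ev(9) single(9)])+
  have sixeven: "even ((c0+c1+d0)+(c1+c2+d2)+(c3+c4+d1)+(c4+c5+d0)+(c6+c7+d2)+(c7+c8+d1))"
    by ((rule ev | rule dvd_add)+)
  \<comment> \<open>Handshake: all inner degrees add up to twice the weight. Six of them are even,
    so the three at the ports cannot all be odd, and an even positive one is at least 2.\<close>
  have "(c0+c1+d0)+(c1+c2+d2)+(c3+c4+d1)+(c4+c5+d0)+(c6+c7+d2)+(c7+c8+d1) + ((c8+c0)+(c2+c3)+(c5+c6)) =
      2*(c0+c1+c2+c3+c4+c5+c6+c7+c8+d0+d1+d2)" (is "?l + ?r = 2*?t") by simp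
  hence "even (?l + ?r)" by (metis dvd_triv_left)
  hence "even ((c8+c0)+(c2+c3)+(c5+c6))" using sixeven by (metis even_add)
  hence "even (c8+c0) \<or> even (c2+c3) \<or> even (c5+c6)" by (metis odd_add)
  hence "c8+c0 \<ge> 2 \<or> c2+c3 \<ge> 2 \<or> c5+c6 \<ge> 2"
    using even_pos[OF _ single(1)] even_pos[OF _ single(4)] even_pos[OF _ single(7)] by blast
  moreover have "c8+c0 \<ge> 1" "c2+c3 \<ge> 1" "c5+c6 \<ge> 1" using single(1,4,7) by linarith+
  moreover have "(c0+c1+d0)+(c1+c2+d2)+(c3+c4+d1)+(c4+c5+d0)+(c6+c7+d2)+(c7+c8+d1)+(c8+c0)+(c2+c3)+(c5+c6) \<le> 16"
    using le by linarith
  ultimately have "c0+c1+d0=2 \<and> c1+c2+d2=2 \<and> c3+c4+d1=2 \<and> c4+c5+d0=2 \<and> c6+c7+d2=2 \<and> c7+c8+d1=2 \<and>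
    (c8+c0=2 \<and> c2+c3=1 \<and> c5+c6=1 \<or> c8+c0=1 \<and> c2+c3=2 \<and> c5+c6=1 \<or> c8+c0=1 \<and> c2+c3=1 \<and> c5+c6=2)"
    by (intro degrees_tight deg) assumption+
  hence eqs: "c0+c1+d0=2" "c1+c2+d2=2" "c3+c4+d1=2" "c4+c5+d0=2" "c6+c7+d2=2" "c7+c8+d1=2"
     and cases: "c8+c0=2 \<and> c2+c3=1 \<and> c5+c6=1 \<or> c8+c0=1 \<and> c2+c3=2 \<and> c5+c6=1 \<or> c8+c0=1 \<and> c2+c3=1 \<and> c5+c6=2"
    by blast+
  have q: "c8+c0 \<le> 2" "c2+c3 \<le> 2" "c5+c6 \<le> 2" using cases by linarith+
  \<comment> \<open>An edge of multiplicity 2 would exhaust the degrees of both its ends and cut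
    this pair off from the rest.\<close>
  have "c0 \<le> 1" using q(1) eqs(1) pairs(1) by linarith
  moreover have "c2 \<le> 1" using q(2) eqs(2) pairs(3) by linarith
  moreover have "c3 \<le> 1" using q(2) eqs(3) pairs(4) by linarith
  moreover have "c5 \<le> 1" using q(3) eqs(4) pairs(6) by linarith
  moreover have "c6 \<le> 1" using q(3) eqs(5) pairs(7) by linarith
  moreover have "c8 \<le> 1" using q(1) eqs(6) pairs(9) by linarith
  moreover have "d0 \<le> 1" using eqs(1,4) pairs(10) by linarith
  moreover have "d1 \<le> 1" using eqs(3,6) pairs(11) by linarith
  moreover have "d2 \<le> 1" using eqs(2,5) pairs(12) by linarith
  ultimately have le1: "c0 \<le> 1" "c2 \<le> 1" "c3 \<le> 1" "c5 \<le> 1" "c6 \<le> 1" "c8 \<le> 1" "d0 \<le> 1" "d1 \<le> 1" "d2 \<le> 1" .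
  from cases show False
  proof (elim disjE conjE)
    assume *: "c8+c0=2" "c2+c3=1" "c5+c6=1"
    hence "c8 = 1" "c0 = 1" using le1(1,6) by linarith+
    thus False
      by (rule two_factor_disconnected) (fact * eqs le1 pairs fives)+
  next
    \<comment> \<open>The rotation by 3 along the 9-cycle is a symmetry that permutes the ports and
      the chords cyclically; the instantiations here and below apply it once and twice.\<close>
    assume *: "c8+c0=1" "c2+c3=2" "c5+c6=1"
    hence "c2 = 1" "c3 = 1" using le1(2,3) by linarith+
    thus False
      by (rule two_factor_disconnected[of c2 c3 c4 d1 c5 d0 c6 c7 d2 c8 c0 c1]) (fact * eqs le1 pairs fives)+
  next
    assume *: "c8+c0=1" "c2+c3=1" "c5+c6=2"
    hence "c5 = 1" "c6 = 1" using le1(4,5) by linarith+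
    thus False
      by (rule two_factor_disconnected[of c5 c6 c7 d2 c8 d1 c0 c1 d0 c2 c3 c4]) (fact * eqs le1 pairs fives)+
  qed
qed

section \<open>Tours as Eulerian multiplicities\<close>

text \<open>Connectedness is phrased by cuts because cuts pull back along a contraction, and because
  a violated cut is itself the witness that an edge is a bridge.\<close>

definition spanning_eulerian :: "'a set \<Rightarrow> ('a \<Rightarrow> 'a \<Rightarrow> bool) \<Rightarrow> ('a \<Rightarrow> 'a \<Rightarrow> nat) \<Rightarrow> bool" where
  "spanning_eulerian V E m \<longleftrightarrow>
     (\<forall>x y. m x y = m y x) \<and> (\<forall>x y. m x y \<le> 2) \<and> (\<forall>x y. m x y > 0 \<longrightarrow> E x y) \<and>
     (\<forall>x\<in>V. even (\<Sum>y\<in>V. m x y)) \<and>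
     (\<forall>U. U \<subseteq> V \<and> U \<noteq> {} \<and> U \<noteq> V \<longrightarrow> (\<exists>x\<in>U. \<exists>y\<in>V - U. m x y > 0))"

text \<open>Every edge is counted from both ends, so a bound \<open>2 * L\<close> speaks of
  \<open>L\<close> traversals.\<close>

definition total_mult :: "'a set \<Rightarrow> ('a \<Rightarrow> 'a \<Rightarrow> nat) \<Rightarrow> nat" where
  "total_mult V m = (\<Sum>x\<in>V. \<Sum>y\<in>V. m x y)"

fun step_count :: "'a list \<Rightarrow> 'a \<Rightarrow> 'a \<Rightarrow> nat" where
  "step_count (u # v # w) x y =
     (if x = u \<and> y = v \<or> x = v \<and> y = u then 1 else 0) + step_count (v # w) x y"
| "step_count _ x y = 0"

lemma step_count_commute: "step_count w x y = step_count w y x"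
  by (induction w x y rule: step_count.induct) auto

lemma step_count_pos_edge:
  assumes "\<And>i. Suc i < length w \<Longrightarrow> E (w ! i) (w ! Suc i)" "\<And>x y. E x y \<Longrightarrow> E y x"
    and "step_count w x y > 0"
  shows "E x y"
  using assms(1,3)
proof (induction w x y rule: step_count.induct)
  case (1 u v w x y)
  have "E u v" using "1.prems"(1)[of 0] by simp
  moreover have "E x y" if "step_count (v # w) x y > 0"
    using "1.IH" "1.prems"(1)[of "Suc i" for i] that by simp
  ultimately show ?case using "1.prems"(2) assms(2) by (auto split: if_splits)
qed auto

text \<open>Each visit to \<open>x\<close> uses one step in and one step out, except that the first
  visit of the walk has no step in and the last no step out; the \<open>of_bool\<close> terms supply
  these.\<close>

lemma step_count_degree:
  assumes "finite V" "set w \<subseteq> V" "w \<noteq> []" "\<And>i. Suc i < length w \<Longrightarrow> w ! i \<noteq> w ! Suc i"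
  shows "(\<Sum>y\<in>V. step_count w x y) + of_bool (x = hd w) + of_bool (x = last w) = 2 * count_list w x"
  using assms(2-)
proof (induction w rule: induct_list012)
  case (3 u v w)
  have "u \<noteq> v" using "3.prems"(3)[of 0] by simp
  have "(\<Sum>y\<in>V. step_count (v # w) x y) + of_bool (x = v) + of_bool (x = last (v # w)) = 2 * count_list (v # w) x"
    using "3.IH"(2) "3.prems"(1) "3.prems"(3)[of "Suc i" for i] by simp
  moreover have "(\<Sum>y\<in>V. if x = u \<and> y = v \<or> x = v \<and> y = u then 1 else 0 :: nat) = of_bool (x = u) + of_bool (x = v)"
    using "3.prems"(1) \<open>finite V\<close> \<open>u \<noteq> v\<close> by (cases "x = u"; cases "x = v") auto
  ultimately show ?case using \<open>u \<noteq> v\<close> by (auto simp: sum.distrib)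
qed auto

lemma step_count_total:
  assumes "finite V" "set w \<subseteq> V" "w \<noteq> []" "\<And>i. Suc i < length w \<Longrightarrow> w ! i \<noteq> w ! Suc i"
  shows "total_mult V (step_count w) = 2 * (length w - 1)"
proof -
  have "(\<Sum>x\<in>V. (\<Sum>y\<in>V. step_count w x y) + of_bool (x = hd w) + of_bool (x = last w)) = (\<Sum>x\<in>V. 2 * count_list w x)"
    by (intro sum.cong refl step_count_degree assms)
  hence "total_mult V (step_count w) + (\<Sum>x\<in>V. of_bool (x = hd w)) + (\<Sum>x\<in>V. of_bool (x = last w)) = 2 * (\<Sum>x\<in>V. count_list w x)"
    by (simp add: total_mult_def sum.distrib sum_distrib_left)
  moreover have "(\<Sum>x\<in>V. count_list w x) = length w"
    using assms(1,2) by (rule sum_count_set[rotated])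
  moreover have "hd w \<in> V" "last w \<in> V" using assms(2,3) by auto
  hence "(\<Sum>x\<in>V. of_bool (x = hd w) :: nat) = 1" "(\<Sum>x\<in>V. of_bool (x = last w) :: nat) = 1"
    using assms(1) by (simp_all add: of_bool_def)
  ultimately show ?thesis by simp
qed

lemma step_count_cut:
  assumes "set w \<inter> U \<noteq> {}" "\<not> set w \<subseteq> U"
  shows "\<exists>x\<in>U. \<exists>y\<in>set w - U. step_count w x y > 0"
  using assms
proof (induction w)
  case (Cons u w)
  show ?case
  proof (cases w)
    case Nil
    thus ?thesis using Cons.prems by auto
  next
    case (Cons v w')
    consider "u \<in> U" "v \<notin> U" | "u \<notin> U" "v \<in> U" | "u \<in> U" "v \<in> U" | "u \<notin> U" "v \<notin> U" by blast
    thus ?thesis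
    proof cases
      case 1
      thus ?thesis using Cons by (intro bexI[of _ u] bexI[of _ v]) auto
    next
      case 2
      thus ?thesis using Cons by (intro bexI[of _ v] bexI[of _ u]) auto
    next
      case 3
      hence "set w \<inter> U \<noteq> {}" "\<not> set w \<subseteq> U" using Cons Cons.prems by auto
      from Cons.IH[OF this] show ?thesis using Cons by fastforce
    next
      case 4
      hence "set w \<inter> U \<noteq> {}" "\<not> set w \<subseteq> U" using Cons Cons.prems by auto
      from Cons.IH[OF this] show ?thesis using Cons by fastforce
    qed
  qed
qed auto

lemma tsp_tour_spanning_eulerian:
  assumes "simple_graph V E" "tsp_tour V E w"
  obtains m where "spanning_eulerian V E m" "total_mult V m \<le> 2 * tour_length w"
proof
  \<comment> \<open>Traversing an edge twice less preserves parity, and connectivity unless the edge disappears.\<close>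
  define r where "r n = (if n = 0 then 0 else if odd n then 1 else 2 :: nat)" for n :: nat
  let ?m = "\<lambda>x y. r (step_count w x y)"
  have r: "r n \<le> n" "even (r n) = even n" "r n \<le> 2" "r n > 0 \<longleftrightarrow> n > 0" for n
    unfolding r_def by (auto elim!: evenE)
  have fin: "finite V" and sym: "\<And>x y. E x y \<Longrightarrow> E y x" and irr: "\<And>x. \<not> E x x"
    using assms(1) by (auto simp: simple_graph_def)
  have w: "w \<noteq> []" "hd w = last w" "set w = V" "\<And>i. Suc i < length w \<Longrightarrow> E (w ! i) (w ! Suc i)"
    using assms(2) by (auto simp: tsp_tour_def)
  have neq: "w ! i \<noteq> w ! Suc i" if "Suc i < length w" for i
    using w(4)[OF that] irr by metis
  have even_sum: "even (\<Sum>y\<in>A. r (f y)) = even (\<Sum>y\<in>A. f y)" if "finite A" for A :: "'a set" and f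
    using that by induction (auto simp: r)
  have "even (\<Sum>y\<in>V. step_count w x y)" for x
  proof -
    \<comment> \<open>The walk is closed, so both end corrections fall on the same vertex and cannot
      spoil parity.\<close>
    have "(\<Sum>y\<in>V. step_count w x y) + 2 * of_bool (x = hd w) = 2 * count_list w x"
      using step_count_degree[OF fin _ w(1) neq, of x] w(2,3) by simp
    thus ?thesis by (metis dvd_add_left_iff dvd_triv_left)
  qed
  moreover have "\<exists>x\<in>U. \<exists>y\<in>V - U. r (step_count w x y) > 0" if "U \<subseteq> V" "U \<noteq> {}" "U \<noteq> V" for U
    using step_count_cut[of w U] that w(3) by (auto simp: r)
  moreover have "E x y" if "step_count w x y > 0" for x y
    using step_count_pos_edge[of w E x y] w(4) sym that by blast
  ultimately show "spanning_eulerian V E ?m"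
    unfolding spanning_eulerian_def using fin
    by (auto simp: r even_sum step_count_commute[of w])
  have "total_mult V ?m \<le> total_mult V (step_count w)"
    unfolding total_mult_def by (intro sum_mono r)
  also have "\<dots> = 2 * tour_length w"
    using step_count_total[OF fin _ w(1) neq] w(3) by (simp add: tour_length_def)
  finally show "total_mult V ?m \<le> 2 * tour_length w" .
qed

text \<open>Handshake lemma: the entries off the diagonal come in equal pairs.\<close>

lemma even_sum_symmetric:
  fixes p :: "'a \<Rightarrow> 'a \<Rightarrow> nat"
  assumes "finite K" "\<And>x y. p x y = p y x" "\<And>x. p x x = 0"
  shows "even (\<Sum>x\<in>K. \<Sum>y\<in>K. p x y)"
  using assms(1)
proof induction
  case (insert z K)
  have "(\<Sum>x\<in>K. p x z) = (\<Sum>x\<in>K. p z x)" by (intro sum.cong refl assms(2))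
  thus ?case using insert by (simp add: sum.distrib assms(3))
qed simp

text \<open>The cut around \<open>x\<close> is crossed, and parity lifts 1 to 2.\<close>

lemma spanning_eulerian_degree_ge_2:
  assumes "spanning_eulerian V E m" "finite V" "x \<in> V" "V \<noteq> {x}"
  shows "(\<Sum>y\<in>V. m x y) \<ge> 2"
proof -
  obtain y where "y \<in> V" "m x y > 0"
    using assms unfolding spanning_eulerian_def
    by (metis DiffD1 empty_subsetI insert_not_empty insert_subset singletonD)
  hence "(\<Sum>y\<in>V. m x y) > 0" using assms(2) by (metis gr0I sum_eq_0_iff)
  moreover have "even (\<Sum>y\<in>V. m x y)" using assms(1,3) by (auto simp: spanning_eulerian_def)
  ultimately show ?thesis by (intro even_pos)
qed

text \<open>Deleting both copies keeps all degrees even, so only a cut can fail afterwards; such a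
  cut was crossed by \<open>u z\<close> alone, which is then a bridge. The 4 is the multiplicity 2
  seen from both ends.\<close>

lemma drop_double_edge:
  assumes "spanning_eulerian V E m" "finite V" "u \<in> V" "z \<in> V" "u \<noteq> z" "m u z = 2"
  defines "m' \<equiv> \<lambda>x y. if x = u \<and> y = z \<or> x = z \<and> y = u then 0 else m x y"
  shows "spanning_eulerian V E m' \<and> total_mult V m = total_mult V m' + 4 \<or>
    (\<exists>U\<subseteq>V. u \<notin> U \<and> z \<in> U \<and> (\<forall>x\<in>U. \<forall>y\<in>V - U. m x y > 0 \<longrightarrow> x = z \<and> y = u))"
proof (cases "\<forall>U. U \<subseteq> V \<and> U \<noteq> {} \<and> U \<noteq> V \<longrightarrow> (\<exists>x\<in>U. \<exists>y\<in>V - U. m' x y > 0)")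
  case True
  have sym: "m x y = m y x" for x y using assms(1) by (auto simp: spanning_eulerian_def)
  have deg: "(\<Sum>y\<in>V. m x y) = (\<Sum>y\<in>V. m' x y) + (if x = u then 2 else 0) + (if x = z then 2 else 0)" if "x \<in> V" for x
  proof -
    have "(\<Sum>y\<in>V. m x y) = (\<Sum>y\<in>V. m' x y + (if x = u \<and> y = z then 2 else 0) + (if x = z \<and> y = u then 2 else 0))"
      using assms(5,6) sym by (intro sum.cong) (auto simp: m'_def)
    thus ?thesis using assms(2-5) by (auto simp: sum.distrib)
  qed
  have "total_mult V m = (\<Sum>x\<in>V. (\<Sum>y\<in>V. m' x y) + (if x = u then 2 else 0) + (if x = z then 2 else 0))"
    unfolding total_mult_def by (intro sum.cong refl deg)
  hence "total_mult V m = total_mult V m' + 4"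
    using assms(2-4) by (simp add: sum.distrib total_mult_def)
  moreover have "even (\<Sum>y\<in>V. m' x y)" if "x \<in> V" for x
    using deg[OF that] assms(1) that unfolding spanning_eulerian_def by (auto split: if_splits)
  hence "spanning_eulerian V E m'"
    using assms(1) True unfolding spanning_eulerian_def by (auto simp: m'_def)
  ultimately show ?thesis by blast
next
  case False
  then obtain U where U: "U \<subseteq> V" "U \<noteq> {}" "U \<noteq> V" "\<And>x y. x \<in> U \<Longrightarrow> y \<in> V - U \<Longrightarrow> m' x y = 0"
    by auto
  then obtain x y where xy: "x \<in> U" "y \<in> V - U" "m x y > 0"
    using assms(1) unfolding spanning_eulerian_def by meson
  have cross: "x = u \<and> y = z \<or> x = z \<and> y = u" if "x \<in> U" "y \<in> V - U" "m x y > 0" for x y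
    using U(4)[OF that(1,2)] that(3) by (auto simp: m'_def split: if_splits)
  have sym: "m x y = m y x" for x y using assms(1) by (auto simp: spanning_eulerian_def)
  from cross[OF xy] consider "z \<in> U" "u \<in> V - U" | "u \<in> U" "z \<in> V - U" using xy by blast
  thus ?thesis
  proof cases
    case 1
    thus ?thesis using U(1) cross by (intro disjI2 exI[of _ U]) blast
  next
    case 2
    \<comment> \<open>The violated cut has \<open>z\<close> on its far side; its complement is the
      required set.\<close>
    have "x = z \<and> y = u" if "x \<in> V - U" "y \<in> V - (V - U)" "m x y > 0" for x y
      using cross[of y x] that 2 sym by auto
    thus ?thesis using 2 by (intro disjI2 exI[of _ "V - U"]) blast
  qed
qed

section \<open>Connectedness by closed sets\<close>

lemma connected_on_iff_closed:
  assumes "symp E"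
  shows "connected_on U E \<longleftrightarrow>
    (\<forall>W\<subseteq>U. W \<noteq> {} \<and> (\<forall>x\<in>W. \<forall>y\<in>U. E x y \<longrightarrow> y \<in> W) \<longrightarrow> W = U)"
proof
  assume con: "connected_on U E"
  show "\<forall>W\<subseteq>U. W \<noteq> {} \<and> (\<forall>x\<in>W. \<forall>y\<in>U. E x y \<longrightarrow> y \<in> W) \<longrightarrow> W = U"
  proof (intro allI impI, elim conjE)
    fix W assume W: "W \<subseteq> U" "W \<noteq> {}" and cl: "\<forall>x\<in>W. \<forall>y\<in>U. E x y \<longrightarrow> y \<in> W"
    then obtain u where "u \<in> W" by blast
    have "z \<in> W" if "z \<in> U" for z
    proof -
      have "(\<lambda>x y. E x y \<and> x \<in> U \<and> y \<in> U)\<^sup>*\<^sup>* u z"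
        using con that \<open>u \<in> W\<close> W(1) by (auto simp: connected_on_def)
      thus ?thesis by induction (use \<open>u \<in> W\<close> cl in auto)
    qed
    thus "W = U" using W(1) by blast
  qed
next
  assume cl: "\<forall>W\<subseteq>U. W \<noteq> {} \<and> (\<forall>x\<in>W. \<forall>y\<in>U. E x y \<longrightarrow> y \<in> W) \<longrightarrow> W = U"
  show "connected_on U E"
    unfolding connected_on_def
  proof (intro ballI)
    fix u v assume "u \<in> U" "v \<in> U"
    let ?R = "\<lambda>x y. E x y \<and> x \<in> U \<and> y \<in> U"
    \<comment> \<open>The set reachable from \<open>u\<close> is closed, hence everything.\<close>
    let ?W = "{z \<in> U. ?R\<^sup>*\<^sup>* u z}"
    have "?W = U"
      using cl[rule_format, of ?W] \<open>u \<in> U\<close> by (auto intro: rtranclp.rtrancl_into_rtrancl)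
    thus "?R\<^sup>*\<^sup>* u v" using \<open>v \<in> U\<close> by blast
  qed
qed

lemma disjoint_triple_misses:
  assumes "finite S" "card S < 3" "A \<inter> B = {}" "A \<inter> C = {}" "B \<inter> C = {}"
  shows "A \<inter> S = {} \<or> B \<inter> S = {} \<or> C \<inter> S = {}"
proof (rule ccontr)
  assume "\<not> ?thesis"
  then obtain x y z where "x \<in> A \<inter> S" "y \<in> B \<inter> S" "z \<in> C \<inter> S" by blast
  moreover from this have "x \<noteq> y" "x \<noteq> z" "y \<noteq> z" using assms(3-5) by blast+
  ultimately have "{x, y, z} \<subseteq> S" "card {x, y, z} = 3" by auto
  thus False using assms(1,2) card_mono by (metis leD)
qed

text \<open>The form in which 3-connectedness is inherited: a closed set of the new graph induces
  one of the old graph, and no walk has to be translated.\<close>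

lemma k_connected_closed_set:
  assumes "k_connected k V E" "symp E" "S \<subseteq> V" "card S < k" "W \<subseteq> V - S" "W \<noteq> {}"
    and "\<forall>x\<in>W. \<forall>y\<in>V - S. E x y \<longrightarrow> y \<in> W"
  shows "W = V - S"
proof -
  have "connected_on (V - S) E" using assms(1,3,4) unfolding k_connected_def by blast
  note imp = connected_on_iff_closed[OF assms(2), THEN iffD1, OF this, THEN spec, of W]
  show ?thesis by (rule mp[OF mp[OF imp assms(5)] conjI[OF assms(6,7)]])
qed

section \<open>Replacing a vertex by the fragment\<close>

text \<open>
  The Petersen graph minus a vertex, drawn as a 9-cycle with three chords; the neighbours of the
  missing vertex are \<open>0\<close>, \<open>3\<close> and \<open>6\<close>.
\<close>

definition frag_edges :: "(nat \<times> nat) set" where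
  "frag_edges = {(0,1), (1,2), (2,3), (3,4), (4,5), (5,6), (6,7), (7,8), (8,0), (1,5), (4,8), (7,2)}"

definition frag :: "nat \<Rightarrow> nat \<Rightarrow> bool" where
  "frag i j \<longleftrightarrow> (i, j) \<in> frag_edges \<or> (j, i) \<in> frag_edges"

lemma frag_sym: "frag i j \<Longrightarrow> frag j i"
  by (auto simp: frag_def)

lemma frag_irrefl: "\<not> frag i i"
  by (auto simp: frag_def frag_edges_def)

lemma frag_less: "frag i j \<Longrightarrow> i < 9 \<and> j < 9"
  by (auto simp: frag_def frag_edges_def)

lemma less_9_cases:
  assumes "k < (9::nat)"
  obtains "k = 0" | "k = 1" | "k = 2" | "k = 3" | "k = 4" | "k = 5" | "k = 6" | "k = 7" | "k = 8"
  using assms by linarith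

lemma less_3_cases:
  assumes "i < (3::nat)"
  obtains "i = 0" | "i = 1" | "i = 2"
  using assms by linarith

lemma frag_neighbours:
  "frag 0 j \<longleftrightarrow> j = 1 \<or> j = 8"
  "frag 1 j \<longleftrightarrow> j = 0 \<or> j = 2 \<or> j = 5"
  "frag 2 j \<longleftrightarrow> j = 1 \<or> j = 3 \<or> j = 7"
  "frag 3 j \<longleftrightarrow> j = 2 \<or> j = 4"
  "frag 4 j \<longleftrightarrow> j = 3 \<or> j = 5 \<or> j = 8"
  "frag 5 j \<longleftrightarrow> j = 4 \<or> j = 6 \<or> j = 1"
  "frag 6 j \<longleftrightarrow> j = 5 \<or> j = 7"
  "frag 7 j \<longleftrightarrow> j = 6 \<or> j = 8 \<or> j = 2"
  "frag 8 j \<longleftrightarrow> j = 7 \<or> j = 0 \<or> j = 4"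
  by (auto simp: frag_def frag_edges_def)

text \<open>\<open>N\<close> lies above all old vertices, so \<open>N + k\<close> with
  \<open>k < 9\<close> are fresh names for the fragment; \<open>a\<close> numbers the neighbours of
  \<open>v\<close>, and \<open>a i\<close> will be attached to port \<open>3 * i\<close>.\<close>

locale vertex_blowup =
  fixes V :: "nat set" and E :: "nat \<Rightarrow> nat \<Rightarrow> bool" and v N :: nat and a :: "nat \<Rightarrow> nat"
  assumes simple: "simple_graph V E" and v: "v \<in> V" and N: "V \<subseteq> {..<N}"
    and inj: "inj_on a {..<3}" and nbrs: "E v y \<longleftrightarrow> y \<in> a ` {..<3}"
begin

definition V' :: "nat set" where
  "V' = (V - {v}) \<union> {N..<N+9}"

definition E' :: "nat \<Rightarrow> nat \<Rightarrow> bool" where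
  "E' x y \<longleftrightarrow> x \<in> V - {v} \<and> y \<in> V - {v} \<and> E x y \<or> (\<exists>i j. x = N + i \<and> y = N + j \<and> frag i j)
     \<or> (\<exists>i<3. x = a i \<and> y = N + 3 * i \<or> x = N + 3 * i \<and> y = a i)"

lemma fin: "finite V" and E_V: "E x y \<Longrightarrow> x \<in> V \<and> y \<in> V" and E_sym: "E x y \<Longrightarrow> E y x" and E_irrefl: "\<not> E x x"
  using simple by (auto simp: simple_graph_def)

lemma less_N: "x \<in> V \<Longrightarrow> x < N" using N by auto

lemma a_nbr: "i < 3 \<Longrightarrow> E v (a i)" using nbrs by auto

lemma a_in: "i < 3 \<Longrightarrow> a i \<in> V" "i < 3 \<Longrightarrow> a i \<noteq> v"
  using a_nbr E_V E_irrefl by metis+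

lemma a_neq_inner: "i < 3 \<Longrightarrow> a i \<noteq> N + j"
  using less_N[OF a_in(1), of i] by auto

lemma a_eq_iff: "i < 3 \<Longrightarrow> j < 3 \<Longrightarrow> a i = a j \<longleftrightarrow> i = j"
  using inj by (auto simp: inj_on_def)

lemma E_v_iff: "E x v \<longleftrightarrow> (\<exists>i<3. x = a i)"
  using nbrs E_sym by (metis imageE imageI lessThan_iff)

lemma E'_outer: "x \<in> V - {v} \<Longrightarrow> y \<in> V - {v} \<Longrightarrow> E' x y \<longleftrightarrow> E x y"
  using less_N[of x] less_N[of y] by (auto simp: E'_def)

lemma E'_inner: "E' (N + i) (N + j) \<longleftrightarrow> frag i j"
  using less_N[of "N + i"] less_N[of "N + j"] a_neq_inner[THEN not_sym] by (auto simp: E'_def)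

lemma E'_cross: "x \<in> V - {v} \<Longrightarrow> E' x (N + j) \<longleftrightarrow> (\<exists>i<3. x = a i \<and> j = 3 * i)"
  using less_N[of x] less_N[of "N + j"] less_N[OF a_in(1)] by (auto simp: E'_def)

lemma E'_sym: "E' x y \<Longrightarrow> E' y x"
  unfolding E'_def using E_sym frag_sym by blast

lemma V'_cases:
  assumes "x \<in> V'"
  obtains (outer) "x \<in> V - {v}" | (inner) k where "k < 9" "x = N + k"
proof (cases "x \<in> V - {v}")
  case False
  hence "x - N < 9" "x = N + (x - N)" using assms by (auto simp: V'_def)
  thus ?thesis using inner by blast
qed (use outer in auto)

lemma inner_in: "k < 9 \<Longrightarrow> N + k \<in> V'" and outer_in: "x \<in> V - {v} \<Longrightarrow> x \<in> V'"
  by (auto simp: V'_def)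

lemma outer_inner_disjoint: "(V - {v}) \<inter> {N..<N+9} = {}"
  using N by auto

lemma simple': "simple_graph V' E'"
proof -
  have "x \<in> V' \<and> y \<in> V'" if "E' x y" for x y
    using that a_in unfolding E'_def V'_def by (auto dest: frag_less)
  moreover have "\<not> E' x x" for x
    using E_irrefl frag_irrefl less_N[OF a_in(1)] unfolding E'_def by (metis add_left_cancel not_add_less1)
  ultimately show ?thesis
    using E'_sym fin by (auto simp: simple_graph_def V'_def)
qed

lemma card': "card V' = card V + 8"
proof -
  have "card V' = card (V - {v}) + card {N..<N+9}"
    unfolding V'_def using outer_inner_disjoint fin by (intro card_Un_disjoint) auto
  moreover have "card V > 0" using v fin by (auto simp: card_gt_0_iff)
  ultimately show ?thesis using v fin by simp
qed

lemma cubic':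
  assumes "cubic V E"
  shows "cubic V' E'"
  unfolding cubic_def
proof
  fix x assume "x \<in> V'"
  thus "degree V' E' x = 3"
  proof (cases rule: V'_cases)
    case outer
    have deg: "card {w \<in> V. E x w} = 3" using assms outer by (auto simp: cubic_def degree_def)
    have out: "{w \<in> V - {v}. E' x w} = {w \<in> V. E x w} - {v}"
      using E'_outer[OF outer] by auto
    show ?thesis
    proof (cases "E x v")
      case True
      then obtain i where i: "i < 3" "x = a i" using E_v_iff by auto
      have "{w \<in> {N..<N+9}. E' x w} = {N + 3 * i}"
      proof -
        have "E' x w \<longleftrightarrow> w = N + 3 * i" if "w \<in> {N..<N+9}" for w
          using E'_cross[OF outer, of "w - N"] that i a_eq_iff by auto
        thus ?thesis using i by auto
      qed
      \<comment> \<open>The lost neighbour \<open>v\<close> is replaced by exactly one port.\<close>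
      hence "{w \<in> V'. E' x w} = insert (N + 3 * i) ({w \<in> V. E x w} - {v})"
        using out by (auto simp: V'_def)
      moreover have "N + 3 * i \<notin> V" using less_N by force
      ultimately show ?thesis using deg fin v True by (simp add: degree_def)
    next
      case False
      have "\<not> E' x w" if "w \<in> {N..<N+9}" for w
        using E'_cross[OF outer, of "w - N"] that False E_v_iff by auto
      hence "{w \<in> V'. E' x w} = {w \<in> V. E x w}"
        using out False by (auto simp: V'_def)
      thus ?thesis using deg by (simp add: degree_def)
    qed
  next
    case (inner k)
    have nb: "{w \<in> V'. E' (N + k) w} = (+) N ` {j. frag k j} \<union> {w. \<exists>i<3. k = 3 * i \<and> w = a i}"
    proof (intro equalityI subsetI)
      fix w assume "w \<in> {w \<in> V'. E' (N + k) w}"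
      hence w: "w \<in> V'" "E' (N + k) w" "E' w (N + k)" using E'_sym by auto
      from w(1) show "w \<in> (+) N ` {j. frag k j} \<union> {w. \<exists>i<3. k = 3 * i \<and> w = a i}"
        by (cases rule: V'_cases) (use w E'_cross E'_inner in auto)
    next
      fix w assume "w \<in> (+) N ` {j. frag k j} \<union> {w. \<exists>i<3. k = 3 * i \<and> w = a i}"
      thus "w \<in> {w \<in> V'. E' (N + k) w}"
        using E'_inner a_in E'_cross E'_sym inner_in outer_in by (auto dest: frag_less)
    qed
    have lt: "a 0 < N" "a 1 < N" "a 2 < N" using less_N a_in by auto
    have port: "{w. \<exists>i<3. k = 3 * i \<and> w = a i} =
        (if k = 0 then {a 0} else if k = 3 then {a 1} else if k = 6 then {a 2} else {})"
      by (auto elim!: less_3_cases)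
    have "frag k j \<longleftrightarrow> j \<in> (if k = 0 then {1,8} else if k = 1 then {0,2,5} else if k = 2 then {1,3,7}
       else if k = 3 then {2,4} else if k = 4 then {3,5,8} else if k = 5 then {4,6,1} else if k = 6 then {5,7}
       else if k = 7 then {6,8,2} else {7,0,4})" (is "_ \<longleftrightarrow> j \<in> ?nb") for j
      using inner(1) by (rule less_9_cases) (simp_all add: frag_neighbours[simplified])
    hence frag: "{j. frag k j} = ?nb" by blast
    show ?thesis
      unfolding inner(2) degree_def nb port frag
      using inner(1) by (rule less_9_cases) (use lt in auto)
  qed
qed

section \<open>3-connectedness of the new graph\<close>

lemma closed_follows_path:
  assumes cl: "\<forall>x\<in>W. \<forall>y\<in>V' - S. E' x y \<longrightarrow> y \<in> W"
    and "successively frag (k # p)" "N + k \<in> W" "\<And>l. l \<in> set p \<Longrightarrow> N + l \<notin> S"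
  shows "N + last (k # p) \<in> W"
  using assms(2-)
proof (induction p arbitrary: k)
  case (Cons l p)
  have "N + l \<in> W"
    using cl Cons.prems E'_inner[of k l] inner_in[of l] frag_less[of k l] by auto
  thus ?case using Cons by simp
qed simp

text \<open>
  Three paths from \<open>k\<close> to the ports that are disjoint outside \<open>k\<close> cannot all be blocked by
  two vertices.
\<close>

lemma fan_escapes:
  assumes cl: "\<forall>x\<in>W. \<forall>y\<in>V' - S. E' x y \<longrightarrow> y \<in> W"
    and S: "finite S" "card S < 3" and k: "N + k \<in> W"
    and path: "successively frag (k # p)" "last (k # p) = 0"
      "successively frag (k # q)" "last (k # q) = 3" "successively frag (k # r)" "last (k # r) = 6"
    and disj: "set p \<inter> set q = {}" "set p \<inter> set r = {}" "set q \<inter> set r = {}"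
  shows "\<exists>i<3. a i \<in> W"
proof -
  \<comment> \<open>The exit \<open>a i\<close> belongs to the obstacle set because \<open>S\<close>
    may contain it too; the start \<open>k\<close> does not, since it is already in
    \<open>W\<close>.\<close>
  define B where "B s i = insert (a i) ((+) N ` set s)" for s i
  have exit: "a i \<in> W"
    if "i < 3" "B s i \<inter> S = {}" "successively frag (k # s)" "last (k # s) = 3 * i" for s i
  proof -
    have "N + l \<notin> S" if "l \<in> set s" for l
      using that \<open>B s i \<inter> S = {}\<close> by (auto simp: B_def)
    hence "N + last (k # s) \<in> W"
      using closed_follows_path[of W S, OF cl that(3) k] by blast
    moreover have "E' (N + 3 * i) (a i)" using E'_cross[of "a i"] E'_sym a_in that(1) by auto
    ultimately show ?thesis
      using cl that outer_in[of "a i"] a_in[of i] by (auto simp: B_def)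
  qed
  have "B s i \<inter> B t j = {}" if "i < 3" "j < 3" "i \<noteq> j" "set s \<inter> set t = {}" for s t i j
    using that a_eq_iff a_neq_inner by (auto simp: B_def dest: not_sym)
  hence "B p 0 \<inter> B q 1 = {}" "B p 0 \<inter> B r 2 = {}" "B q 1 \<inter> B r 2 = {}" using disj by auto
  from disjoint_triple_misses[OF S this] show ?thesis
  proof (elim disjE)
    assume "B p 0 \<inter> S = {}"
    thus ?thesis using exit[of 0 p] path by (intro exI[of _ 0]) simp
  next
    assume "B q 1 \<inter> S = {}"
    thus ?thesis using exit[of 1 q] path by (intro exI[of _ 1]) simp
  next
    assume "B r 2 \<inter> S = {}"
    thus ?thesis using exit[of 2 r] path by (intro exI[of _ 2]) simp
  qed
qed

text \<open>The listed fans are three paths from \<open>k\<close> to the deleted vertex of the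
  3-connected Petersen graph, without that vertex; for a port one of them is empty.\<close>

lemma port_reachable:
  assumes cl: "\<forall>x\<in>W. \<forall>y\<in>V' - S. E' x y \<longrightarrow> y \<in> W"
    and S: "finite S" "card S < 3" and k: "N + k \<in> W" "k < 9"
  shows "\<exists>i<3. a i \<in> W"
  using k(2)
proof (rule less_9_cases)
  note fan = fan_escapes[of W S k, OF cl S k(1)]
  note simps = frag_neighbours[simplified]
  show ?thesis if "k = 0" using that by (intro fan[of "[]" "[1,2,3]" "[8,7,6]"]) (simp_all add: simps)
  show ?thesis if "k = 1" using that by (intro fan[of "[0]" "[2,3]" "[5,6]"]) (simp_all add: simps)
  show ?thesis if "k = 2" using that by (intro fan[of "[1,0]" "[3]" "[7,6]"]) (simp_all add: simps)
  show ?thesis if "k = 3" using that by (intro fan[of "[2,1,0]" "[]" "[4,5,6]"]) (simp_all add: simps)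
  show ?thesis if "k = 4" using that by (intro fan[of "[8,0]" "[3]" "[5,6]"]) (simp_all add: simps)
  show ?thesis if "k = 5" using that by (intro fan[of "[1,0]" "[4,3]" "[6]"]) (simp_all add: simps)
  show ?thesis if "k = 6" using that by (intro fan[of "[7,8,0]" "[5,4,3]" "[]"]) (simp_all add: simps)
  show ?thesis if "k = 7" using that by (intro fan[of "[8,0]" "[2,3]" "[6]"]) (simp_all add: simps)
  show ?thesis if "k = 8" using that by (intro fan[of "[0]" "[4,3]" "[7,6]"]) (simp_all add: simps)
qed

text \<open>As \<open>S\<close> spends a vertex on the fragment, its outer part together with
  \<open>v\<close> still has fewer than 3 elements, so the old graph stays connected without them.
  Every nonempty closed set reaches the outer part, hence \<open>W\<close> and its complement cannot
  both be nonempty.\<close>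

lemma closed_set_meeting_fragment:
  assumes "k_connected 3 V E" and S: "S \<subseteq> V'" "card S < 3" "S \<inter> {N..<N+9} \<noteq> {}"
    and W: "W \<subseteq> V' - S" "W \<noteq> {}" and cl: "\<forall>x\<in>W. \<forall>y\<in>V' - S. E' x y \<longrightarrow> y \<in> W"
  shows "W = V' - S"
proof -
  let ?O = "V - {v}" and ?T = "insert v (S \<inter> (V - {v}))"
  have finS: "finite S" using S(1) by (rule finite_subset) (simp add: V'_def fin)
  have "S \<inter> ?O \<subset> S" using S(3) outer_inner_disjoint by blast
  hence "card (S \<inter> ?O) < card S" by (rule psubset_card_mono[OF finS])
  hence T: "card ?T < 3" using S(2) finS by (simp add: card_insert_if)
  have meets: "U \<inter> ?O \<noteq> {}"
    if U: "U \<subseteq> V' - S" "U \<noteq> {}" "\<forall>x\<in>U. \<forall>y\<in>V' - S. E' x y \<longrightarrow> y \<in> U" for U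
  proof -
    obtain x where "x \<in> U" "x \<in> V'" using U(1,2) by blast
    from this(2) show ?thesis
    proof (cases rule: V'_cases)
      case (inner k)
      then obtain i where "i < 3" "a i \<in> U"
        using port_reachable[OF U(3) finS S(2), of k] \<open>x \<in> U\<close> by blast
      thus ?thesis using a_in[of i] by blast
    qed (use \<open>x \<in> U\<close> in blast)
  qed
  have "W \<inter> ?O = V - ?T"
  proof (rule k_connected_closed_set[OF assms(1)])
    show "symp E" using E_sym by (rule sympI)
    show "?T \<subseteq> V" using v by blast
    show "W \<inter> ?O \<subseteq> V - ?T" using W(1) by blast
    show "W \<inter> ?O \<noteq> {}" using meets[OF W cl] .
    show "\<forall>x\<in>W \<inter> ?O. \<forall>y\<in>V - ?T. E x y \<longrightarrow> y \<in> W \<inter> ?O"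
    proof (intro ballI impI)
      fix x y assume "x \<in> W \<inter> ?O" and y: "y \<in> V - ?T" and "E x y"
      hence "E' x y" "y \<in> V' - S" using E'_outer[of x y] outer_in[of y] by auto
      thus "y \<in> W \<inter> ?O" using cl \<open>x \<in> W \<inter> ?O\<close> y by blast
    qed
  qed (rule T)
  hence OW: "?O - S \<subseteq> W" by blast
  have "V' - S - W = {}"
  proof (rule ccontr)
    assume ne: "V' - S - W \<noteq> {}"
    have "\<forall>x\<in>V' - S - W. \<forall>y\<in>V' - S. E' x y \<longrightarrow> y \<in> V' - S - W"
      using cl E'_sym by blast
    from meets[OF _ ne this] show False using OW by blast
  qed
  thus ?thesis using W(1) by blast
qed

text \<open>The intact fragment lies in \<open>W\<close> as a whole or not at all, so contracting it
  to \<open>v\<close> turns \<open>W\<close> into the closed set \<open>U\<close> of the old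
  graph.\<close>

lemma closed_set_avoiding_fragment:
  assumes "k_connected 3 V E" and S: "S \<subseteq> V'" "card S < 3" "S \<inter> {N..<N+9} = {}"
    and W: "W \<subseteq> V' - S" "W \<noteq> {}" and cl: "\<forall>x\<in>W. \<forall>y\<in>V' - S. E' x y \<longrightarrow> y \<in> W"
  shows "W = V' - S"
proof -
  let ?O = "V - {v}" and ?F = "{N..<N+9}"
  have SO: "S \<subseteq> ?O" using S(1,3) by (auto simp: V'_def)
  have inner_W: "N + l \<in> W" if "N + k \<in> W" "frag k l" for k l
  proof -
    have "l < 9" using that(2) frag_less by blast
    hence "N + l \<in> V' - S" using inner_in[of l] S(3) by auto
    thus ?thesis using cl that E'_inner[of k l] by blast
  qed
  have all: "N + l \<in> W" if k: "N + k \<in> W" "k < 9" "l < 9" for k l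
  proof -
    \<comment> \<open>The listed steps form a spanning tree directed towards \<open>0\<close>; from
      \<open>0\<close> the cycle is then followed upwards.\<close>
    have "N + 0 \<in> W"
      using k(2)
      by (rule less_9_cases)
        (use k(1) inner_W[of 1 0] inner_W[of 2 1] inner_W[of 3 2] inner_W[of 4 8] inner_W[of 5 1]
           inner_W[of 6 7] inner_W[of 7 8] inner_W[of 8 0]
         in \<open>simp_all add: frag_neighbours[simplified]\<close>)
    thus ?thesis
      using k(3)
      by - (erule less_9_cases,
        use inner_W[of 0 1] inner_W[of 1 2] inner_W[of 2 3] inner_W[of 3 4] inner_W[of 4 5]
          inner_W[of 5 6] inner_W[of 6 7] inner_W[of 7 8]
        in \<open>simp_all add: frag_neighbours[simplified]\<close>)
  qed
  define U where "U = W \<inter> ?O \<union> (if N \<in> W then {v} else {})"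
  have v_U: "v \<in> U \<longleftrightarrow> N \<in> W" and O_U: "x \<in> ?O \<Longrightarrow> x \<in> U \<longleftrightarrow> x \<in> W" for x
    by (auto simp: U_def)
  have "U = V - S"
  proof (rule k_connected_closed_set[OF assms(1)])
    show "symp E" using E_sym by (rule sympI)
    show "S \<subseteq> V" using SO by blast
    show "U \<subseteq> V - S" using SO W(1) v by (auto simp: U_def split: if_splits)
    show "U \<noteq> {}"
    proof -
      obtain x where x: "x \<in> W" "x \<in> V'" using W by blast
      from x(2) show ?thesis
      proof (cases rule: V'_cases)
        case outer
        thus ?thesis using O_U x(1) by blast
      next
        case (inner k)
        hence "N \<in> W" using all[of k 0] x(1) by simp
        thus ?thesis using v_U by blast
      qed
    qed
    show "\<forall>x\<in>U. \<forall>y\<in>V - S. E x y \<longrightarrow> y \<in> U"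
    proof (intro ballI impI)
      fix x y assume xy: "x \<in> U" "y \<in> V - S" "E x y"
      consider "x = v" | "x \<in> ?O" "y = v" | "x \<in> ?O" "y \<in> ?O"
        using xy E_V by blast
      thus "y \<in> U"
      proof cases
        case 1
        then obtain i where i: "i < 3" "y = a i" using nbrs xy(3) by auto
        hence y: "y \<in> ?O" using a_in[of i] by blast
        have "N + 3 * i \<in> W" using all[of 0 "3 * i"] v_U xy(1) 1 i by simp
        moreover have "E' (N + 3 * i) y" using E'_cross[OF y, of "3 * i"] E'_sym i by blast
        moreover have "y \<in> V' - S" using outer_in[OF y] xy(2) by blast
        ultimately have "y \<in> W" using cl by blast
        thus ?thesis using O_U y by blast
      next
        case 2
        then obtain i where i: "i < 3" "x = a i" using E_v_iff xy(3) by auto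
        have "E' x (N + 3 * i)" using E'_cross[OF 2(1), of "3 * i"] i by blast
        moreover have "N + 3 * i \<in> V' - S" using inner_in[of "3 * i"] S(3) i by auto
        ultimately have "N + 3 * i \<in> W" using cl O_U xy(1) 2(1) by blast
        thus ?thesis using all[of "3 * i" 0] i 2 v_U by simp
      next
        case 3
        hence "E' x y" "y \<in> V' - S" "x \<in> W" using E'_outer[of x y] outer_in[of y] xy O_U by blast+
        thus ?thesis using cl O_U 3 by blast
      qed
    qed
  qed (rule S(2))
  hence "N \<in> W" "?O - S \<subseteq> W" using SO v v_U O_U by blast+
  have "V' - S \<subseteq> W"
  proof
    fix x assume x: "x \<in> V' - S"
    hence "x \<in> V'" by blast
    thus "x \<in> W"
    proof (cases rule: V'_cases)
      case (inner k)
      thus ?thesis using all[of 0 k] \<open>N \<in> W\<close> by simp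
    qed (use x \<open>?O - S \<subseteq> W\<close> in blast)
  qed
  thus ?thesis using W(1) by blast
qed

lemma k_connected':
  assumes "k_connected 3 V E"
  shows "k_connected 3 V' E'"
proof -
  have "symp E'" using E'_sym by (rule sympI)
  moreover have "card V' > 3" using assms card' by (simp add: k_connected_def)
  moreover have "connected_on (V' - S) E'" if "S \<subseteq> V'" "card S < 3" for S
    unfolding connected_on_iff_closed[OF \<open>symp E'\<close>]
  proof (intro allI impI, elim conjE)
    fix W assume "W \<subseteq> V' - S" "W \<noteq> {}" "\<forall>x\<in>W. \<forall>y\<in>V' - S. E' x y \<longrightarrow> y \<in> W"
    thus "W = V' - S"
      using closed_set_meeting_fragment[OF assms that] closed_set_avoiding_fragment[OF assms that] by metis
  qed
  ultimately show ?thesis by (simp add: k_connected_def)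
qed
end

section \<open>Contracting the fragment\<close>

text \<open>Adding the six inequalities counts the edges at the ports once and the other six edges
  twice. Since the former carry positive weight, twice the total is at least 13.\<close>

lemma fragment_weight:
  fixes c0 c1 c2 c3 c4 c5 c6 c7 c8 d0 d1 d2 :: nat
  assumes "c0+c1+d0\<ge>2" "c1+c2+d2\<ge>2" "c3+c4+d1\<ge>2" "c4+c5+d0\<ge>2" "c6+c7+d2\<ge>2" "c7+c8+d1\<ge>2"
    and "c8+c0+c2+c3+c5+c6 > 0"
  shows "c0+c1+c2+c3+c4+c5+c6+c7+c8+d0+d1+d2 \<ge> 7"
  using assms by linarith

lemma sum_lessThan_9: "(\<Sum>j<9. f j) = f 0 + f 1 + f 2 + f 3 + f 4 + f 5 + f 6 + f 7 + f 8"
  for f :: "nat \<Rightarrow> nat"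
proof -
  have "{..<9::nat} = {0,1,2,3,4,5,6,7,8}" by auto
  thus ?thesis by (simp add: add.assoc)
qed

lemma lessThan_3: "{..<3::nat} = {0,1,2}"
  by auto

locale blowup_multigraph = vertex_blowup +
  fixes m :: "nat \<Rightarrow> nat \<Rightarrow> nat"
  assumes m: "spanning_eulerian V' E' m"
begin

lemma m_sym: "m x y = m y x" and m_le_2: "m x y \<le> 2" and m_E': "m x y > 0 \<Longrightarrow> E' x y"
  using m by (simp_all add: spanning_eulerian_def)

lemma m_even: "x \<in> V' \<Longrightarrow> even (\<Sum>y\<in>V'. m x y)"
  using m unfolding spanning_eulerian_def by (elim conjE) (erule bspec)

lemma m_cut:
  assumes "U \<subseteq> V'" "x \<in> U" "y \<in> V'" "y \<notin> U"
  shows "\<exists>x\<in>U. \<exists>y\<in>V' - U. m x y > 0"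
proof -
  have "U \<noteq> {}" "U \<noteq> V'" using assms by blast+
  thus ?thesis using m assms(1) unfolding spanning_eulerian_def by blast
qed

definition p :: "nat \<Rightarrow> nat \<Rightarrow> nat" where "p i j = m (N + i) (N + j)"
definition port :: "nat \<Rightarrow> nat" where "port i = m (a i) (N + 3 * i)"

lemma p_sym: "p i j = p j i"
  using m_sym by (simp add: p_def)

lemma p_flip:
  "p 0 8 = p 8 0" "p 1 0 = p 0 1" "p 2 1 = p 1 2" "p 3 2 = p 2 3" "p 4 3 = p 3 4" "p 5 4 = p 4 5"
  "p 6 5 = p 5 6" "p 7 6 = p 6 7" "p 8 7 = p 7 8" "p 5 1 = p 1 5" "p 8 4 = p 4 8" "p 2 7 = p 7 2"
  by (rule p_sym)+

lemma p_frag: "p i j > 0 \<Longrightarrow> frag i j"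
  using m_E' E'_inner by (auto simp: p_def)

lemma p_zero: "\<not> frag i j \<Longrightarrow> p i j = 0"
  using p_frag by blast

lemma cross_pos:
  assumes "x \<in> V - {v}" "m x (N + j) > 0"
  obtains i where "i < 3" "x = a i" "j = 3 * i"
  using m_E'[OF assms(2)] E'_cross[OF assms(1)] that by auto

lemma sum_fragment: "(\<Sum>t\<in>{N..<N+9}. f t) = (\<Sum>j<9. f (N + j))" for f :: "nat \<Rightarrow> nat"
  by (rule sum.reindex_bij_witness[of _ "\<lambda>j. N + j" "\<lambda>t. t - N"]) auto

lemma sum_V': "(\<Sum>t\<in>V'. f t) = (\<Sum>t\<in>V - {v}. f t) + (\<Sum>t\<in>{N..<N+9}. f t)" for f :: "nat \<Rightarrow> nat"
  unfolding V'_def using outer_inner_disjoint fin by (intro sum.union_disjoint) auto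

lemma sum_to_fragment: "i < 3 \<Longrightarrow> (\<Sum>t\<in>{N..<N+9}. m (a i) t) = port i"
proof -
  assume i: "i < 3"
  have "m (a i) (N + j) = (if j = 3 * i then port i else 0)" for j
  proof (cases "m (a i) (N + j) > 0")
    case True
    have "a i \<in> V - {v}" using a_in[OF i] by simp
    from this True obtain i' where "i' < 3" "a i = a i'" "j = 3 * i'"
      by (rule cross_pos)
    thus ?thesis using a_eq_iff i by (simp add: port_def)
  qed (auto simp: port_def)
  thus ?thesis using i by (simp add: sum_fragment)
qed

lemma sum_to_fragment_pos:
  assumes "x \<in> V - {v}" "(\<Sum>t\<in>{N..<N+9}. m x t) > 0"
  obtains i where "i < 3" "x = a i"
proof -
  have "\<exists>j. m x (N + j) \<noteq> 0"
  proof (rule ccontr)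
    assume "\<not> ?thesis"
    thus False using assms(2) unfolding sum_fragment by simp
  qed
  then obtain j where "m x (N + j) > 0" by auto
  with assms(1) show ?thesis by (rule cross_pos) (rule that)
qed

lemma sum_from_port: "i < 3 \<Longrightarrow> (\<Sum>t\<in>V - {v}. m (N + 3 * i) t) = port i"
proof -
  assume i: "i < 3"
  have "m (N + 3 * i) t = (if t = a i then port i else 0)" if "t \<in> V - {v}" for t
  proof (cases "m t (N + 3 * i) > 0")
    case True
    with \<open>t \<in> V - {v}\<close> obtain i' where "i' < 3" "t = a i'" "3 * i = 3 * i'"
      by (rule cross_pos)
    thus ?thesis by (simp add: port_def m_sym)
  next
    case False
    thus ?thesis using m_sym[of t "N + 3 * i"] m_sym[of "a i" "N + 3 * i"] by (auto simp: port_def)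
  qed
  hence "(\<Sum>t\<in>V - {v}. m (N + 3 * i) t) = (\<Sum>t\<in>V - {v}. if t = a i then port i else 0)"
    by (intro sum.cong) auto
  thus ?thesis using a_in[OF i] fin by simp
qed

lemma sum_from_inner: "(\<And>i. i < 3 \<Longrightarrow> k \<noteq> 3 * i) \<Longrightarrow> (\<Sum>t\<in>V - {v}. m (N + k) t) = 0"
proof (rule sum.neutral, rule ballI, rule ccontr)
  fix t assume *: "\<And>i. i < 3 \<Longrightarrow> k \<noteq> 3 * i" "t \<in> V - {v}" "m (N + k) t \<noteq> 0"
  hence "m t (N + k) > 0" using m_sym[of t] by simp
  with *(2) show False by (rule cross_pos) (simp add: *(1))
qed

lemma inner_degree:
  "(\<Sum>t\<in>V'. m (N + 0) t) = p 8 0 + p 0 1 + port 0"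
  "(\<Sum>t\<in>V'. m (N + 1) t) = p 0 1 + p 1 2 + p 1 5"
  "(\<Sum>t\<in>V'. m (N + 2) t) = p 1 2 + p 2 3 + p 7 2"
  "(\<Sum>t\<in>V'. m (N + 3) t) = p 2 3 + p 3 4 + port 1"
  "(\<Sum>t\<in>V'. m (N + 4) t) = p 3 4 + p 4 5 + p 4 8"
  "(\<Sum>t\<in>V'. m (N + 5) t) = p 4 5 + p 5 6 + p 1 5"
  "(\<Sum>t\<in>V'. m (N + 6) t) = p 5 6 + p 6 7 + port 2"
  "(\<Sum>t\<in>V'. m (N + 7) t) = p 6 7 + p 7 8 + p 7 2"
  "(\<Sum>t\<in>V'. m (N + 8) t) = p 7 8 + p 8 0 + p 4 8"
proof -
  have split: "(\<Sum>t\<in>V'. m (N + k) t) = (\<Sum>t\<in>V - {v}. m (N + k) t) + (\<Sum>j<9. p k j)" for k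
    by (simp add: sum_V' sum_fragment p_def)
  have nonport: "(\<Sum>t\<in>V - {v}. m (N + k) t) = 0" if "k \<in> {1,2,4,5,7,8}" for k
    using that by (intro sum_from_inner) (auto elim!: less_3_cases)
  show "(\<Sum>t\<in>V'. m (N + 0) t) = p 8 0 + p 0 1 + port 0"
    unfolding split sum_lessThan_9 using sum_from_port[of 0] p_flip by (simp add: p_zero frag_neighbours[simplified])
  show "(\<Sum>t\<in>V'. m (N + 1) t) = p 0 1 + p 1 2 + p 1 5"
    unfolding split sum_lessThan_9 using nonport[of 1] p_flip by (simp add: p_zero frag_neighbours[simplified])
  show "(\<Sum>t\<in>V'. m (N + 2) t) = p 1 2 + p 2 3 + p 7 2"
    unfolding split sum_lessThan_9 using nonport[of 2] p_flip by (simp add: p_zero frag_neighbours[simplified])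
  show "(\<Sum>t\<in>V'. m (N + 3) t) = p 2 3 + p 3 4 + port 1"
    unfolding split sum_lessThan_9 using sum_from_port[of 1] p_flip by (simp add: p_zero frag_neighbours[simplified])
  show "(\<Sum>t\<in>V'. m (N + 4) t) = p 3 4 + p 4 5 + p 4 8"
    unfolding split sum_lessThan_9 using nonport[of 4] p_flip by (simp add: p_zero frag_neighbours[simplified])
  show "(\<Sum>t\<in>V'. m (N + 5) t) = p 4 5 + p 5 6 + p 1 5"
    unfolding split sum_lessThan_9 using nonport[of 5] p_flip by (simp add: p_zero frag_neighbours[simplified])
  show "(\<Sum>t\<in>V'. m (N + 6) t) = p 5 6 + p 6 7 + port 2"
    unfolding split sum_lessThan_9 using sum_from_port[of 2] p_flip by (simp add: p_zero frag_neighbours[simplified])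
  show "(\<Sum>t\<in>V'. m (N + 7) t) = p 6 7 + p 7 8 + p 7 2"
    unfolding split sum_lessThan_9 using nonport[of 7] p_flip by (simp add: p_zero frag_neighbours[simplified])
  show "(\<Sum>t\<in>V'. m (N + 8) t) = p 7 8 + p 8 0 + p 4 8"
    unfolding split sum_lessThan_9 using nonport[of 8] p_flip by (simp add: p_zero frag_neighbours[simplified])
qed

definition inner_total :: nat where
  "inner_total = p 0 1 + p 1 2 + p 2 3 + p 3 4 + p 4 5 + p 5 6 + p 6 7 + p 7 8 + p 8 0 + p 1 5 + p 4 8 + p 7 2"

lemma sum_inner: "(\<Sum>s\<in>{N..<N+9}. \<Sum>t\<in>{N..<N+9}. m s t) = 2 * inner_total"
proof -
  have "(\<Sum>s\<in>{N..<N+9}. \<Sum>t\<in>{N..<N+9}. m s t) = (\<Sum>i<9. \<Sum>j<9. p i j)"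
    by (simp add: sum_fragment p_def)
  also have "\<dots> = 2 * inner_total"
    unfolding sum_lessThan_9 inner_total_def using p_flip by (simp add: p_zero frag_neighbours[simplified])
  finally show ?thesis .
qed

definition contraction :: "nat \<Rightarrow> nat \<Rightarrow> nat" where
  "contraction x y =
    (if x \<in> V - {v} \<and> y \<in> V - {v} then m x y
     else if x = v \<and> y \<in> V - {v} then \<Sum>t\<in>{N..<N+9}. m y t
     else if y = v \<and> x \<in> V - {v} then \<Sum>t\<in>{N..<N+9}. m x t
     else 0)"

lemma contraction_outer: "x \<in> V - {v} \<Longrightarrow> y \<in> V - {v} \<Longrightarrow> contraction x y = m x y"
  by (simp add: contraction_def)

lemma contraction_v: "x \<in> V - {v} \<Longrightarrow> contraction x v = (\<Sum>t\<in>{N..<N+9}. m x t)"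
  "x \<in> V - {v} \<Longrightarrow> contraction v x = (\<Sum>t\<in>{N..<N+9}. m x t)" "contraction v v = 0"
  by (simp_all add: contraction_def)

lemma contraction_port: "i < 3 \<Longrightarrow> contraction (a i) v = port i" "i < 3 \<Longrightarrow> contraction v (a i) = port i"
  using a_in by (simp_all add: contraction_v sum_to_fragment)

lemma sum_V: "(\<Sum>y\<in>V. f y) = f v + (\<Sum>y\<in>V - {v}. f y)" for f :: "nat \<Rightarrow> nat"
  using fin v by (rule sum.remove)

lemma contraction_degree: "x \<in> V - {v} \<Longrightarrow> (\<Sum>y\<in>V. contraction x y) = (\<Sum>y\<in>V'. m x y)"
  by (simp add: sum_V sum_V' contraction_v contraction_outer)

text \<open>The degree sum of the fragment counts its outgoing edges once and its inner edges
  twice.\<close>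

lemma contraction_degree_v:
  "(\<Sum>y\<in>V. contraction v y) + 2 * inner_total = (\<Sum>s\<in>{N..<N+9}. \<Sum>y\<in>V'. m s y)"
proof -
  have "(\<Sum>y\<in>V. contraction v y) = (\<Sum>y\<in>V - {v}. \<Sum>t\<in>{N..<N+9}. m y t)"
    by (simp add: sum_V contraction_v)
  also have "\<dots> = (\<Sum>t\<in>{N..<N+9}. \<Sum>y\<in>V - {v}. m t y)"
    by (subst sum.swap) (intro sum.cong refl m_sym)
  finally show ?thesis by (simp add: sum_V' sum.distrib flip: sum_inner)
qed

lemma total_contraction: "total_mult V' m = total_mult V contraction + 2 * inner_total"
proof -
  have "total_mult V' m = (\<Sum>x\<in>V - {v}. \<Sum>y\<in>V'. m x y) + (\<Sum>s\<in>{N..<N+9}. \<Sum>y\<in>V'. m s y)"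
    unfolding total_mult_def by (rule sum_V')
  also have "\<dots> = (\<Sum>x\<in>V - {v}. \<Sum>y\<in>V. contraction x y) + ((\<Sum>y\<in>V. contraction v y) + 2 * inner_total)"
    by (simp add: contraction_degree contraction_degree_v)
  also have "\<dots> = total_mult V contraction + 2 * inner_total"
    unfolding total_mult_def by (subst (3) sum_V) simp
  finally show ?thesis .
qed

lemma contraction_sym: "contraction x y = contraction y x"
  unfolding contraction_def using m_sym[of x y]
  by (cases "x=v"; cases "y=v"; cases "x\<in>V"; cases "y\<in>V"; simp only: Diff_iff singleton_iff if_True if_False simp_thms)

text \<open>Different ports lead to different neighbours, so merging at \<open>v\<close> adds
  nothing up and multiplicities stay at most 2. The degree at \<open>v\<close> differs from a sum of
  even degrees by twice the inner weight. A cut pulls back by putting the fragment in place of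
  \<open>v\<close>.\<close>

lemma spanning_eulerian_contraction: "spanning_eulerian V E contraction"
  unfolding spanning_eulerian_def
proof (intro conjI allI ballI impI)
  fix x y
  show "contraction x y = contraction y x" by (rule contraction_sym)
  have le: "(\<Sum>t\<in>{N..<N+9}. m z t) \<le> 2" if "z \<in> V - {v}" for z
  proof (cases "(\<Sum>t\<in>{N..<N+9}. m z t) > 0")
    case True
    with that obtain i where "i < 3" "z = a i" by (rule sum_to_fragment_pos)
    thus ?thesis using sum_to_fragment m_le_2 by (simp add: port_def)
  qed simp
  show "contraction x y \<le> 2" using le m_le_2 by (simp add: contraction_def)
  have pos: "E z v" if "z \<in> V - {v}" "(\<Sum>t\<in>{N..<N+9}. m z t) > 0" for z
  proof -
    from that obtain i where "i < 3" "z = a i" by (rule sum_to_fragment_pos)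
    thus ?thesis using E_v_iff by blast
  qed
  show "E x y" if c: "contraction x y > 0"
  proof -
    consider "x \<in> V - {v}" "y \<in> V - {v}" | "x = v" "y \<in> V - {v}" | "y = v" "x \<in> V - {v}"
      using c unfolding contraction_def by presburger
    thus ?thesis
    proof cases
      case 1
      hence "m x y > 0" using c by (simp add: contraction_outer)
      thus ?thesis using m_E' E'_outer[OF 1] by blast
    next
      case 2
      hence "E y v" using pos[of y] c by (simp add: contraction_v)
      thus ?thesis using E_sym 2 by blast
    next
      case 3
      thus ?thesis using pos[of x] c by (simp add: contraction_v)
    qed
  qed
next
  fix x assume x: "x \<in> V"
  show "even (\<Sum>y\<in>V. contraction x y)"
  proof (cases "x = v")
    case True
    have "even (\<Sum>s\<in>{N..<N+9}. \<Sum>y\<in>V'. m s y)"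
      by (intro dvd_sum m_even) (auto simp: V'_def)
    thus ?thesis unfolding True contraction_degree_v[symmetric] by simp
  next
    case False
    thus ?thesis using x contraction_degree m_even outer_in by simp
  qed
next
  fix U assume U: "U \<subseteq> V \<and> U \<noteq> {} \<and> U \<noteq> V"
  let ?W = "(U - {v}) \<union> (if v \<in> U then {N..<N+9} else {})"
  have W: "?W \<subseteq> V'" using U by (auto simp: V'_def)
  obtain y z where "y \<in> U" "z \<in> V" "z \<notin> U" using U by blast
  have "\<exists>y. y \<in> ?W" "\<exists>z\<in>V'. z \<notin> ?W"
  proof -
    show "\<exists>y. y \<in> ?W" using \<open>y \<in> U\<close> by (cases "y = v") (auto intro: exI[of _ N] exI[of _ y])
    show "\<exists>z\<in>V'. z \<notin> ?W"
    proof (cases "z = v")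
      case True
      thus ?thesis using \<open>z \<notin> U\<close> inner_in[of 0] U less_N[of N] by (intro bexI[of _ N]) auto
    next
      case False
      thus ?thesis using \<open>z \<in> V\<close> \<open>z \<notin> U\<close> outer_in[of z] less_N[of z] by (intro bexI[of _ z]) auto
    qed
  qed
  then obtain s t where st: "s \<in> ?W" "t \<in> V' - ?W" "m s t > 0"
    using m_cut[OF W] by blast
  have frag_pos: "contraction w v > 0" "contraction v w > 0"
    if "w \<in> V - {v}" "u \<in> {N..<N+9}" "m w u > 0" for w u
  proof -
    have "(\<Sum>t\<in>{N..<N+9}. m w t) > 0" using that(2,3) sum_eq_0_iff[of "{N..<N+9}" "m w"] by fastforce
    thus "contraction w v > 0" "contraction v w > 0" using that(1) by (simp_all add: contraction_v)
  qed
  have dV: "x \<in> V - {v} \<or> x \<in> {N..<N+9}" if "x \<in> V'" for x using that by (auto simp: V'_def)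
  show "\<exists>x\<in>U. \<exists>y\<in>V - U. contraction x y > 0"
  proof (cases "s \<in> V - {v}")
    case True
    hence sU: "s \<in> U" using st(1) outer_inner_disjoint by (auto split: if_splits)
    show ?thesis
    proof (cases "t \<in> V - {v}")
      case t: True
      hence "t \<notin> U" using st(2) by blast
      thus ?thesis using True t sU st(3) contraction_outer[OF True t] by (intro bexI[of _ s] bexI[of _ t]) auto
    next
      case False
      hence "t \<in> {N..<N+9}" using dV st(2) by blast
      moreover have "v \<notin> U" using calculation st(2) by auto
      ultimately show ?thesis using True sU frag_pos[of s t] st(3) v by blast
    qed
  next
    case False
    hence s: "s \<in> {N..<N+9}" "v \<in> U" using st(1) U by (auto split: if_splits)
    have t: "t \<in> V - {v}" using dV[of t] st(2) s(2) by auto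
    hence "t \<notin> U" using st(2) by blast
    thus ?thesis using frag_pos[of t s] t s st(3) m_sym[of s t] by (intro bexI[of _ v] bexI[of _ t]) auto
  qed
qed

section \<open>Lower bounds for the inner weight\<close>

lemma finite_V': "finite V'"
  using fin by (simp add: V'_def)

lemma degree_ge_2: "k < 9 \<Longrightarrow> (\<Sum>t\<in>V'. m (N + k) t) \<ge> 2"
proof -
  assume "k < 9"
  moreover have "V' \<noteq> {N + k}" using inner_in[of 0] inner_in[of 1] by force
  ultimately show ?thesis
    using spanning_eulerian_degree_ge_2[OF m finite_V'] inner_in by blast
qed

text \<open>A set without ports has no edge to the outside, so its cut in the whole graph is crossed
  inside the fragment.\<close>

lemma fragment_cut:
  assumes "K \<subseteq> {..<9}" "K \<noteq> {}" "\<And>i. i < 3 \<Longrightarrow> 3 * i \<notin> K"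
  shows "\<exists>k\<in>K. \<exists>l. l \<notin> K \<and> frag k l \<and> p k l > 0"
proof -
  let ?W = "(+) N ` K"
  have W: "?W \<subseteq> V'" using assms(1) by (auto simp: V'_def)
  have 0: "0 \<notin> K" using assms(3)[of 0] by simp
  obtain k where "k \<in> K" using assms(2) by blast
  hence "N + k \<in> ?W" "N + 0 \<in> V'" "N + 0 \<notin> ?W" using 0 inner_in[of 0] by auto
  from m_cut[OF W this] obtain s t where st: "s \<in> ?W" "t \<in> V' - ?W" "m s t > 0" by blast
  then obtain k where k: "k \<in> K" "s = N + k" by blast
  have "t \<in> V'" using st(2) by blast
  thus ?thesis
  proof (cases rule: V'_cases)
    case outer
    hence "m t (N + k) > 0" using st(3) k(2) m_sym by simp
    with outer have False by (rule cross_pos) (use assms(3) k(1) in blast)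
    thus ?thesis ..
  next
    case (inner l)
    hence "l \<notin> K" "p k l > 0" using st k by (auto simp: p_def)
    thus ?thesis using p_frag k(1) by blast
  qed
qed

lemma inner_total_ge_7: "inner_total \<ge> 7"
proof -
  \<comment> \<open>These are the vertices other than the ports; leaving them uses an edge at a
    port, whose positive weight gives the step from 6 to 7.\<close>
  have "{1,2,4,5,7,8} \<subseteq> {..<9::nat}" by auto
  moreover have "3 * i \<notin> {1,2,4,5,7,8::nat}" if "i < 3" for i
    using that by (auto elim!: less_3_cases)
  ultimately have "\<exists>k\<in>{1,2,4,5,7,8}. \<exists>l. l \<notin> {1,2,4,5,7,8} \<and> frag k l \<and> p k l > 0"
    by (intro fragment_cut) auto
  hence att: "p 8 0 + p 0 1 + p 2 3 + p 3 4 + p 5 6 + p 6 7 > 0"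
    using p_sym[of 1 0] p_sym[of 4 3] p_sym[of 7 6]
    by (auto simp: frag_neighbours[simplified])
  note deg = degree_ge_2[of 1] degree_ge_2[of 2] degree_ge_2[of 4] degree_ge_2[of 5] degree_ge_2[of 7] degree_ge_2[of 8]
  show ?thesis
    unfolding inner_total_def
    by (rule fragment_weight) (use deg att in \<open>simp_all only: inner_degree; simp\<close>)+
qed

lemma inner_total_ge_9:
  assumes cut: "\<And>K. K \<subseteq> {..<9} \<Longrightarrow> K \<noteq> {} \<Longrightarrow> K \<noteq> {..<9} \<Longrightarrow> \<exists>k\<in>K. \<exists>l. l \<notin> K \<and> p k l > 0"
  shows "inner_total \<ge> 9"
proof -
  have cut': "\<exists>k\<in>K. \<exists>l. l \<notin> K \<and> frag k l \<and> p k l > 0"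
    if "K \<subseteq> {..<9}" "k \<in> K" "z < 9" "z \<notin> K" for K k z
    using cut[of K] that p_frag by blast
  note simps = frag_neighbours[simplified]
  have ev: "even (\<Sum>t\<in>V'. m (N + 0) t)" "even (\<Sum>t\<in>V'. m (N + 1) t)" "even (\<Sum>t\<in>V'. m (N + 2) t)"
    "even (\<Sum>t\<in>V'. m (N + 3) t)" "even (\<Sum>t\<in>V'. m (N + 4) t)" "even (\<Sum>t\<in>V'. m (N + 5) t)"
    "even (\<Sum>t\<in>V'. m (N + 6) t)" "even (\<Sum>t\<in>V'. m (N + 7) t)" "even (\<Sum>t\<in>V'. m (N + 8) t)"
    by (intro m_even inner_in; simp)+
  note even_inner = ev[unfolded inner_degree]
  \<comment> \<open>\<open>cut0\<close> to \<open>cut8\<close> belong to vertices,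
    \<open>cut9\<close> to \<open>cut20\<close> to the twelve edges, \<open>cut21\<close> to
    \<open>cut26\<close> to the 5-cycles: six of the twelve in the Petersen graph avoid the deleted
    vertex.\<close>
  have cut0: "p 8 0 + p 0 1 > 0"
    using cut'[of "{0}" 0 1] by (auto simp: simps p_flip[simplified])
  have cut1: "p 0 1 + p 1 2 + p 1 5 > 0"
    using cut'[of "{1}" 1 0] by (auto simp: simps p_flip[simplified])
  have cut2: "p 1 2 + p 2 3 + p 7 2 > 0"
    using cut'[of "{2}" 2 0] by (auto simp: simps p_flip[simplified])
  have cut3: "p 2 3 + p 3 4 > 0"
    using cut'[of "{3}" 3 0] by (auto simp: simps p_flip[simplified])
  have cut4: "p 3 4 + p 4 5 + p 4 8 > 0"
    using cut'[of "{4}" 4 0] by (auto simp: simps p_flip[simplified])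
  have cut5: "p 4 5 + p 5 6 + p 1 5 > 0"
    using cut'[of "{5}" 5 0] by (auto simp: simps p_flip[simplified])
  have cut6: "p 5 6 + p 6 7 > 0"
    using cut'[of "{6}" 6 0] by (auto simp: simps p_flip[simplified])
  have cut7: "p 6 7 + p 7 8 + p 7 2 > 0"
    using cut'[of "{7}" 7 0] by (auto simp: simps p_flip[simplified])
  have cut8: "p 7 8 + p 8 0 + p 4 8 > 0"
    using cut'[of "{8}" 8 0] by (auto simp: simps p_flip[simplified])
  have cut9: "p 8 0 + p 1 2 + p 1 5 > 0"
    using cut'[of "{0,1}" 0 2] by (auto simp: simps p_flip[simplified])
  have cut10: "p 0 1 + p 1 5 + p 2 3 + p 7 2 > 0"
    using cut'[of "{1,2}" 1 0] by (auto simp: simps p_flip[simplified])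
  have cut11: "p 1 2 + p 7 2 + p 3 4 > 0"
    using cut'[of "{2,3}" 2 0] by (auto simp: simps p_flip[simplified])
  have cut12: "p 2 3 + p 4 5 + p 4 8 > 0"
    using cut'[of "{3,4}" 3 0] by (auto simp: simps p_flip[simplified])
  have cut13: "p 3 4 + p 4 8 + p 5 6 + p 1 5 > 0"
    using cut'[of "{4,5}" 4 0] by (auto simp: simps p_flip[simplified])
  have cut14: "p 4 5 + p 1 5 + p 6 7 > 0"
    using cut'[of "{5,6}" 5 0] by (auto simp: simps p_flip[simplified])
  have cut15: "p 5 6 + p 7 8 + p 7 2 > 0"
    using cut'[of "{6,7}" 6 0] by (auto simp: simps p_flip[simplified])
  have cut16: "p 6 7 + p 7 2 + p 8 0 + p 4 8 > 0"
    using cut'[of "{7,8}" 7 0] by (auto simp: simps p_flip[simplified])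
  have cut17: "p 7 8 + p 4 8 + p 0 1 > 0"
    using cut'[of "{8,0}" 8 1] by (auto simp: simps p_flip[simplified])
  have cut18: "p 0 1 + p 1 2 + p 4 5 + p 5 6 > 0"
    using cut'[of "{1,5}" 1 0] by (auto simp: simps p_flip[simplified])
  have cut19: "p 3 4 + p 4 5 + p 7 8 + p 8 0 > 0"
    using cut'[of "{4,8}" 4 0] by (auto simp: simps p_flip[simplified])
  have cut20: "p 6 7 + p 7 8 + p 1 2 + p 2 3 > 0"
    using cut'[of "{7,2}" 7 0] by (auto simp: simps p_flip[simplified])
  have cut21: "p 0 1 + p 7 2 + p 4 8 + p 5 6 > 0"
    using cut'[of "{1,2,3,4,5}" 1 0] by (auto simp: simps p_flip[simplified])
  have cut22: "p 3 4 + p 1 5 + p 7 2 + p 8 0 > 0"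
    using cut'[of "{4,5,6,7,8}" 4 0] by (auto simp: simps p_flip[simplified])
  have cut23: "p 6 7 + p 4 8 + p 1 5 + p 2 3 > 0"
    using cut'[of "{7,8,0,1,2}" 7 3] by (auto simp: simps p_flip[simplified])
  have cut24: "p 1 2 + p 5 6 + p 3 4 + p 7 8 > 0"
    using cut'[of "{0,1,5,4,8}" 0 2] by (auto simp: simps p_flip[simplified])
  have cut25: "p 4 5 + p 8 0 + p 6 7 + p 1 2 > 0"
    using cut'[of "{3,4,8,7,2}" 3 0] by (auto simp: simps p_flip[simplified])
  have cut26: "p 7 8 + p 2 3 + p 0 1 + p 4 5 > 0"
    using cut'[of "{6,7,2,1,5}" 6 0] by (auto simp: simps p_flip[simplified])
  show ?thesis
    unfolding inner_total_def
    by (rule connected_fragment_weight[where ?x0.0 = "port 0" and ?x1.0 = "port 1" and ?x2.0 = "port 2"])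
      (rule cut0 cut1 cut2 cut3 cut4 cut5 cut6 cut7 cut8 cut9 cut10 cut11 cut12 cut13
        cut14 cut15 cut16 cut17 cut18 cut19 cut20 cut21 cut22 cut23 cut24 cut25 cut26 | rule even_inner)+
qed

text \<open>Handshake on \<open>K\<close>: the degrees are even, edges within \<open>K\<close> count
  twice, and no inner edge leaves \<open>K\<close>, so only the port edges at \<open>K\<close>
  remain.\<close>

lemma port_sum_even:
  assumes "K \<subseteq> {..<9}" "\<And>k l. k \<in> K \<Longrightarrow> l \<in> {..<9} - K \<Longrightarrow> p k l = 0"
  shows "even (\<Sum>i<3. if 3 * i \<in> K then port i else 0)"
proof -
  have finK: "finite K" using assms(1) finite_subset by blast
  have deg: "(\<Sum>t\<in>V'. m (N + k) t) = (\<Sum>i<3. if k = 3 * i then port i else 0) + (\<Sum>l\<in>K. p k l)"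
    if "k \<in> K" for k
  proof -
    have "(\<Sum>t\<in>V - {v}. m (N + k) t) = (\<Sum>i<3. if k = 3 * i then port i else 0)"
    proof (cases "\<exists>i<3. k = 3 * i")
      case True
      then obtain j where j: "j < 3" "k = 3 * j" by blast
      hence "(\<Sum>i<3. if k = 3 * i then port i else 0) = (\<Sum>i<3. if i = j then port i else 0)"
        by (intro sum.cong) auto
      thus ?thesis using j sum_from_port[of j] by simp
    next
      case False
      thus ?thesis using sum_from_inner[of k] by simp
    qed
    moreover have "(\<Sum>t\<in>{N..<N+9}. m (N + k) t) = (\<Sum>l<9. p k l)"
      by (simp add: sum_fragment p_def)
    moreover have "(\<Sum>l<9. p k l) = (\<Sum>l\<in>K. p k l)"
      using assms that by (intro sum.mono_neutral_right) auto
    ultimately show ?thesis by (simp add: sum_V')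
  qed
  have "even (\<Sum>k\<in>K. \<Sum>t\<in>V'. m (N + k) t)"
    using assms(1) by (intro dvd_sum m_even inner_in) auto
  moreover have "(\<Sum>k\<in>K. \<Sum>t\<in>V'. m (N + k) t) =
      (\<Sum>k\<in>K. \<Sum>i<3. if k = 3 * i then port i else 0) + (\<Sum>k\<in>K. \<Sum>l\<in>K. p k l)"
    by (simp only: deg sum.distrib cong: sum.cong)
  moreover have "(\<Sum>k\<in>K. \<Sum>i<3. if k = 3 * i then port i else 0) = (\<Sum>i<3. if 3 * i \<in> K then port i else 0)"
    using finK by (subst sum.swap) (intro sum.cong refl, simp)
  moreover have "even (\<Sum>k\<in>K. \<Sum>l\<in>K. p k l)"
    using finK p_sym by (intro even_sum_symmetric p_zero frag_irrefl) auto
  ultimately show ?thesis by simp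
qed

text \<open>Each used port edge at \<open>K\<close> is doubled, hence a bridge. Adding the far sides
  of these bridges to \<open>K\<close> gives a cut of the whole graph that only an inner edge of the
  fragment can cross.\<close>

lemma no_odd_port_cut:
  assumes bridge: "\<And>i. i < 3 \<Longrightarrow> port i = 2 \<Longrightarrow>
      \<exists>U\<subseteq>V. v \<notin> U \<and> a i \<in> U \<and> (\<forall>x\<in>U. \<forall>y\<in>V - U. contraction x y > 0 \<longrightarrow> x = a i \<and> y = v)"
    and K: "K \<subseteq> {..<9}" "K \<noteq> {}" "K \<noteq> {..<9}" and no_odd: "\<And>i. i < 3 \<Longrightarrow> 3 * i \<in> K \<Longrightarrow> port i \<noteq> 1"
  shows "\<exists>k\<in>K. \<exists>l. l \<notin> K \<and> p k l > 0"
proof -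
  obtain U where U: "\<And>i. i < 3 \<Longrightarrow> port i = 2 \<Longrightarrow> U i \<subseteq> V \<and> v \<notin> U i \<and> a i \<in> U i \<and>
      (\<forall>x\<in>U i. \<forall>y\<in>V - U i. contraction x y > 0 \<longrightarrow> x = a i \<and> y = v)"
    using bridge by metis
  define I where "I = {i. i < 3 \<and> 3 * i \<in> K \<and> port i = 2}"
  let ?B = "\<Union>i\<in>I. U i" and ?F = "(+) N ` K"
  have B: "?B \<subseteq> V - {v}" using U by (auto simp: I_def)
  have F: "?F \<subseteq> {N..<N+9}" using K(1) by auto
  have W: "?F \<union> ?B \<subseteq> V'" using B F by (auto simp: V'_def)
  obtain k where k: "k \<in> K" using K(2) by blast
  obtain z where z: "z < 9" "z \<notin> K" using K(1,3) by auto
  have Nz: "N + z \<notin> ?F \<union> ?B" using z(2) B less_N[of "N + z"] by auto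
  have Nk: "N + k \<in> ?F \<union> ?B" using k by blast
  obtain s t where st: "s \<in> ?F \<union> ?B" "t \<in> V'" "t \<notin> ?F \<union> ?B" "m s t > 0"
    using m_cut[OF W Nk inner_in[OF z(1)] Nz] by blast
  \<comment> \<open>\<open>F\<close> is the copy of \<open>K\<close> when it is the source and the
    fragment when it is the target, \<open>B\<close> a far side, \<open>O\<close> the old vertices.
    \<open>FO\<close> would be a doubled port edge, whose end is in a far side; \<open>BF\<close> is
    the bridge itself, which ends in the copy of \<open>K\<close>; \<open>BO\<close> would be a
    second edge leaving a far side.\<close>
  consider (FF) k l where "s = N + k" "k \<in> K" "t = N + l" | (FO) k where "s = N + k" "k \<in> K" "t \<in> V - {v}"
    | (BF) i l where "i \<in> I" "s \<in> U i" "t = N + l" | (BO) i where "i \<in> I" "s \<in> U i" "t \<in> V - {v}"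
  proof -
    have "(\<exists>l. t = N + l) \<or> t \<in> V - {v}" using st(2) by (rule V'_cases) auto
    thus ?thesis using st(1) FF FO BF BO by blast
  qed
  thus ?thesis
  proof cases
    case FF
    moreover from this have "l \<notin> K" using st(3) by blast
    ultimately show ?thesis using st(4) unfolding p_def by blast
  next
    case FO
    have "m t (N + k) > 0" using st(4) FO(1) m_sym by simp
    with FO(3) obtain i where i: "i < 3" "t = a i" "k = 3 * i" by (rule cross_pos)
    have "port i > 0" using i \<open>m t (N + k) > 0\<close> by (simp add: port_def)
    moreover have "port i \<le> 2" using m_le_2 by (simp add: port_def)
    moreover have "port i \<noteq> 1" using no_odd i FO(2) by blast
    ultimately have "port i = 2" by linarith
    hence "t \<in> ?B" using U[OF i(1)] i FO(2) by (auto simp: I_def)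
    thus ?thesis using st(3) by blast
  next
    case BF
    have i: "i < 3" "port i = 2" "3 * i \<in> K" using BF(1) by (auto simp: I_def)
    have s: "s \<in> V - {v}" using U[OF i(1,2)] BF(2) by blast
    have "m s (N + l) > 0" using st(4) BF(3) by simp
    with s obtain j where j: "j < 3" "s = a j" "l = 3 * j" by (rule cross_pos)
    have "contraction s v > 0"
      using \<open>m s (N + l) > 0\<close> j contraction_port(1)[of j] by (simp add: port_def)
    hence "s = a i" using U[OF i(1,2)] BF(2) v by blast
    hence "l = 3 * i" using j a_eq_iff i(1) by blast
    thus ?thesis using st(3) BF(3) i(3) by blast
  next
    case BO
    have i: "i < 3" "port i = 2" using BO(1) by (auto simp: I_def)
    have s: "s \<in> V - {v}" using U[OF i] BO(2) by blast
    have "t \<notin> U i" using st(3) BO(1) by blast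
    moreover have "contraction s t > 0" using contraction_outer[OF s BO(3)] st(4) by simp
    ultimately have "t = v" using U[OF i] BO(2,3) by blast
    thus ?thesis using BO(3) by blast
  qed
qed

text \<open>By parity the odd port edges, of which there are none or two, lie on the same side of a
  cut of the fragment without inner edges; apply the previous lemma to the other side.\<close>

lemma fragment_connected:
  assumes bridge: "\<And>i. i < 3 \<Longrightarrow> port i = 2 \<Longrightarrow>
      \<exists>U\<subseteq>V. v \<notin> U \<and> a i \<in> U \<and> (\<forall>x\<in>U. \<forall>y\<in>V - U. contraction x y > 0 \<longrightarrow> x = a i \<and> y = v)"
    and K: "K \<subseteq> {..<9}" "K \<noteq> {}" "K \<noteq> {..<9}"
  shows "\<exists>k\<in>K. \<exists>l. l \<notin> K \<and> p k l > 0"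
proof (rule ccontr)
  assume none: "\<not> ?thesis"
  let ?L = "{..<9} - K"
  have zero: "p k l = 0" "p l k = 0" if "k \<in> K" "l \<in> ?L" for k l
  proof -
    show "p k l = 0" using none that by auto
    thus "p l k = 0" by (simp add: p_sym[of l k])
  qed
  have "even (\<Sum>i<3. if 3 * i \<in> K then port i else 0)"
    using K(1) zero by (intro port_sum_even) auto
  hence evK: "even ((if 0 \<in> K then port 0 else 0) + (if 3 \<in> K then port 1 else 0) + (if 6 \<in> K then port 2 else 0))"
    by (simp add: lessThan_3 algebra_simps)
  have "even (\<Sum>i<3. if 3 * i \<in> {..<9} then port i else 0)"
    by (intro port_sum_even) auto
  hence ev: "even (port 0 + port 1 + port 2)"
    by (simp add: lessThan_3 algebra_simps)
  have "(\<exists>i<3. 3 * i \<in> K \<and> port i = 1)"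
    using no_odd_port_cut[OF bridge K] none by blast
  moreover have "(\<exists>i<3. 3 * i \<in> ?L \<and> port i = 1)"
  proof (rule ccontr)
    assume "\<not> ?thesis"
    hence "\<exists>k\<in>?L. \<exists>l. l \<notin> ?L \<and> p k l > 0"
      using K by (intro no_odd_port_cut[OF bridge]) auto
    then obtain k l where kl: "k \<in> ?L" "l \<notin> ?L" "p k l > 0" by blast
    hence "l \<in> K" using frag_less[OF p_frag[OF kl(3)]] by simp
    thus False using zero(2) kl by simp
  qed
  ultimately obtain i j where "i < 3" "3 * i \<in> K" "port i = 1" "j < 3" "3 * j \<in> ?L" "port j = 1"
    by blast
  \<comment> \<open>By \<open>ev\<close> the third port is even, so \<open>K\<close> has exactly one
    odd port, against \<open>evK\<close>.\<close>
  thus False using evK ev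
    by (elim less_3_cases) (auto split: if_splits)
qed

text \<open>Counted from both ends, 18 arises as 4 + 14 if the contraction is not optimal by a
  doubled edge, and as 0 + 18 otherwise.\<close>

lemma total_mult_ge:
  assumes bound: "\<And>c. spanning_eulerian V E c \<Longrightarrow> total_mult V c \<ge> 2 * L"
  shows "total_mult V' m \<ge> 2 * (L + 9)"
proof (cases "\<exists>c. spanning_eulerian V E c \<and> total_mult V contraction = total_mult V c + 4")
  case True
  then obtain c where "spanning_eulerian V E c" "total_mult V contraction = total_mult V c + 4" by blast
  with bound[of c] have "total_mult V contraction \<ge> 2 * L + 4" by simp
  thus ?thesis using inner_total_ge_7 unfolding total_contraction by simp
next
  case False
  \<comment> \<open>Nothing cheaper by 4 exists, so the bridge alternative of
    \<open>drop_double_edge\<close> holds at every doubled port edge.\<close>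
  have "\<exists>U\<subseteq>V. v \<notin> U \<and> a i \<in> U \<and> (\<forall>x\<in>U. \<forall>y\<in>V - U. contraction x y > 0 \<longrightarrow> x = a i \<and> y = v)"
    if "i < 3" "port i = 2" for i
  proof -
    have "contraction v (a i) = 2" using contraction_port(2) that by simp
    from drop_double_edge[OF spanning_eulerian_contraction fin v a_in(1)[OF that(1)]
        a_in(2)[OF that(1), THEN not_sym] this]
    show ?thesis
      by (rule disjE) (use False in blast)
  qed
  hence "inner_total \<ge> 9" by (intro inner_total_ge_9 fragment_connected)
  thus ?thesis using bound[OF spanning_eulerian_contraction] unfolding total_contraction by simp
qed

end

section \<open>Iteration and ratio\<close>

definition tour_bounded :: "nat set \<Rightarrow> (nat \<Rightarrow> nat \<Rightarrow> bool) \<Rightarrow> nat \<Rightarrow> bool" where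
  "tour_bounded V E L \<longleftrightarrow> simple_graph V E \<and> cubic V E \<and> k_connected 3 V E \<and>
     (\<forall>m. spanning_eulerian V E m \<longrightarrow> total_mult V m \<ge> 2 * L)"

lemma tour_bounded_K4: "tour_bounded {..<4} (\<lambda>x y. x < 4 \<and> y < 4 \<and> x \<noteq> y) 4"
  unfolding tour_bounded_def
proof (intro conjI allI impI)
  let ?V = "{..<4::nat}" and ?E = "\<lambda>x y::nat. x < 4 \<and> y < 4 \<and> x \<noteq> y"
  show "simple_graph ?V ?E" by (auto simp: simple_graph_def)
  show "cubic ?V ?E"
    unfolding cubic_def degree_def
  proof
    fix x :: nat assume "x \<in> ?V"
    moreover have "{w \<in> ?V. x < 4 \<and> w < 4 \<and> x \<noteq> w} = ?V - {x}" using calculation by auto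
    ultimately show "card {w \<in> ?V. x < 4 \<and> w < 4 \<and> x \<noteq> w} = 3" by simp
  qed
  have "connected_on (?V - S) ?E" for S
    unfolding connected_on_def
  proof (intro ballI)
    fix x y assume "x \<in> ?V - S" "y \<in> ?V - S"
    thus "(\<lambda>x y. ?E x y \<and> x \<in> ?V - S \<and> y \<in> ?V - S)\<^sup>*\<^sup>* x y"
      by (cases "x = y") auto
  qed
  thus "k_connected 3 ?V ?E" by (simp add: k_connected_def)
  fix m assume m: "spanning_eulerian ?V ?E m"
  \<comment> \<open>Four degrees of at least 2 give the initial bound 4.\<close>
  have "2 \<le> (\<Sum>y\<in>?V. m x y)" if "x \<in> ?V" for x
  proof (rule spanning_eulerian_degree_ge_2[OF m _ that])
    show "?V \<noteq> {x}" by (metis card_lessThan card_1_singleton_iff numeral_eq_one_iff semiring_norm(83) One_nat_def)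
  qed simp
  hence "(\<Sum>x\<in>?V. 2) \<le> total_mult ?V m" unfolding total_mult_def by (rule sum_mono)
  thus "2 * 4 \<le> total_mult ?V m" by simp
qed

text \<open>Any vertex may be blown up. The bound is carried for all spanning Eulerian
  multiplicities, a class that contraction preserves; tours enter only at the very end.\<close>

lemma tour_bounded_step:
  assumes "tour_bounded V E L"
  shows "\<exists>V' E'. tour_bounded V' E' (L + 9) \<and> card V' = card V + 8"
proof -
  have g: "simple_graph V E" "cubic V E" "k_connected 3 V E"
    and bound: "\<And>m. spanning_eulerian V E m \<Longrightarrow> total_mult V m \<ge> 2 * L"
    using assms by (auto simp: tour_bounded_def)
  have fin: "finite V" using g(1) by (simp add: simple_graph_def)
  have "card V > 3" using g(3) by (simp add: k_connected_def)
  then obtain v where v: "v \<in> V" by fastforce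
  have "card {w \<in> V. E v w} = 3" using g(2) v by (simp add: cubic_def degree_def)
  then obtain a :: "nat \<Rightarrow> nat" where a: "bij_betw a {..<3} {w \<in> V. E v w}"
    using ex_bij_betw_nat_finite[of "{w \<in> V. E v w}"] fin by (auto simp: lessThan_atLeast0)
  obtain N where N: "V \<subseteq> {..<N}" using fin unfolding finite_nat_set_iff_bounded by blast
  interpret vertex_blowup V E v N a
  proof
    show "E v y \<longleftrightarrow> y \<in> a ` {..<3}" for y
      using a g(1) by (auto simp: bij_betw_def simple_graph_def)
  qed (use g v N a in \<open>auto simp: bij_betw_def\<close>)
  have "total_mult V' m \<ge> 2 * (L + 9)" if "spanning_eulerian V' E' m" for m
  proof -
    interpret blowup_multigraph V E v N a m
      by unfold_locales (rule that)
    show ?thesis using total_mult_ge[OF bound] by blast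
  qed
  hence "tour_bounded V' E' (L + 9)"
    using simple' cubic'[OF g(2)] k_connected'[OF g(3)] by (simp add: tour_bounded_def)
  thus ?thesis using card' by blast
qed

lemma tour_bounded_family: "\<exists>V E. tour_bounded V E (4 + 9 * n) \<and> card V = 4 + 8 * n"
proof (induction n)
  case 0
  show ?case using tour_bounded_K4 by (intro exI[of _ "{..<4}"]) auto
next
  case (Suc n)
  then obtain V E where VE: "tour_bounded V E (4 + 9 * n)" "card V = 4 + 8 * n" by blast
  show ?case using tour_bounded_step[OF VE(1)] VE(2) by (auto simp: algebra_simps)
qed

theorem theorem3:
  fixes \<epsilon> :: real
  assumes "\<epsilon> > 0"
  shows "\<exists>(V :: nat set) (E :: nat \<Rightarrow> nat \<Rightarrow> bool).
           simple_graph V E \<and> cubic V E \<and> k_connected 3 V E \<and>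
           (\<forall>w. tsp_tour V E w \<longrightarrow> real (tour_length w) \<ge> (1.125 - \<epsilon>) * real (card V))"
proof -
  \<comment> \<open>The product (9/8 - \<epsilon>)(4 + 8n) exceeds 4 + 9n by 1/2 - 4\<epsilon> -
    8n\<epsilon>, which is not positive once 16n\<epsilon> is at least 1.\<close>
  obtain n :: nat where n: "real n \<ge> 1 / (16 * \<epsilon>)" using real_arch_simple by blast
  obtain V E where VE: "tour_bounded V E (4 + 9 * n)" "card V = 4 + 8 * n"
    using tour_bounded_family by blast
  have "real (tour_length w) \<ge> (1.125 - \<epsilon>) * real (card V)" if "tsp_tour V E w" for w
  proof -
    have g: "simple_graph V E" using VE(1) by (simp add: tour_bounded_def)
    obtain m where "spanning_eulerian V E m" "total_mult V m \<le> 2 * tour_length w"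
      using tsp_tour_spanning_eulerian[OF g \<open>tsp_tour V E w\<close>] .
    hence "4 + 9 * n \<le> tour_length w" using VE(1) unfolding tour_bounded_def by fastforce
    hence "real (tour_length w) \<ge> 4 + 9 * real n" by linarith
    moreover have "16 * \<epsilon> * real n \<ge> 1" using n assms by (simp add: field_simps)
    hence "(1.125 - \<epsilon>) * real (card V) \<le> 4 + 9 * real n"
      using assms VE(2) by (simp add: algebra_simps)
    ultimately show ?thesis by linarith
  qed
  thus ?thesis using VE(1) unfolding tour_bounded_def by blast
qed

end
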